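(* Let $\mathcal{H}_A,\mathcal{H}_B$ be finite-dimensional Hilbert spaces with fixed reference bases $\{|i\rangle_A\}$ and $\{|j\rangle_B\}$, and equip $\mathcal{H}_A\otimes\mathcal{H}_B$ with the product reference basis $\{|i\rangle_A|j\rangle_B\}$. For every state $\rho_{AB}$ on $\mathcal{H}_A\otimes\mathcal{H}_B$ with reduced states $\rho_A,\rho_B$, $$C_f(\rho_{AB})\geq \max\{C_r(\rho_A)+C_f(\rho_B),\ C_r(\rho_B)+C_f(\rho_A)\}+E_f(\rho_{AB}).$$
   Context: $S(\rho)=-\mathrm{Tr}\,\rho\log\rho$ is the von Neumann entropy. For a system with reference basis $\{|k\rangle\}$, $\Delta(\rho)=\sum_k |k\rangle\langle k|\rho|k\rangle\langle k|$ is the completely dephasing map. The relative entropy of coherence is $C_r(\rho)=S(\Delta(\rho))-S(\rho)$. The coherence of formation is $C_f(\rho)=\min\sum_i p_i S(\Delta(|\psi_i\rangle\langle\psi_i|))$, the minimum over all pure-state decompositions $\rho=\sum_i p_i|\psi_i\rangle\langle\psi_i|$ (for bipartite states, $\Delta$ is taken with respect to the product basis). The entanglement of formation is $E_f(\rho_{AB})=\min\sum_i p_i S(\mathrm{Tr}_A|\psi_i\rangle\langle\psi_i|_{AB})$, minimized over all pure-state decompositions $\rho_{AB}=\sum_ip_i|\psi_i\rangle\langle\psi_i|_{AB}$. *)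

theory Defs
  imports "Jordan_Normal_Form.Char_Poly"
begin

text \<open>Density matrices on C^n (reference basis = standard basis e_0..e_(n-1)).\<close>
definition density :: "nat \<Rightarrow> complex mat \<Rightarrow> bool" where
  "density n \<rho> \<longleftrightarrow> \<rho> \<in> carrier_mat n n
     \<and> (\<forall>i<n. \<forall>j<n. \<rho> $$ (j, i) = cnj (\<rho> $$ (i, j)))
     \<and> (\<forall>v \<in> carrier_vec n.
          Im (\<Sum>i<n. \<Sum>j<n. cnj (v $ i) * \<rho> $$ (i, j) * v $ j) = 0
        \<and> Re (\<Sum>i<n. \<Sum>j<n. cnj (v $ i) * \<rho> $$ (i, j) * v $ j) \<ge> 0)
     \<and> (\<Sum>i<n. \<rho> $$ (i, i)) = 1"

text \<open>von Neumann entropy: -sum of lambda log lambda over the eigenvalues (with multiplicity,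
  i.e. proots of the characteristic polynomial), base-2 logarithm, with 0 log 0 = 0.\<close>
definition vN_entropy :: "complex mat \<Rightarrow> real" where
  "vN_entropy \<rho> = sum_mset (image_mset (\<lambda>x. - (Re x * log 2 (Re x))) (proots (char_poly \<rho>)))"

definition dephase :: "nat \<Rightarrow> complex mat \<Rightarrow> complex mat" where
  "dephase n \<rho> = mat n n (\<lambda>(i, j). if i = j then \<rho> $$ (i, i) else 0)"

definition rel_coh :: "nat \<Rightarrow> complex mat \<Rightarrow> real" where
  "rel_coh n \<rho> = vN_entropy (dephase n \<rho>) - vN_entropy \<rho>"

definition unit_vec :: "nat \<Rightarrow> complex vec \<Rightarrow> bool" where
  "unit_vec n \<psi> \<longleftrightarrow> \<psi> \<in> carrier_vec n \<and> (\<Sum>i<n. (cmod (\<psi> $ i))\<^sup>2) = 1"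

definition proj :: "nat \<Rightarrow> complex vec \<Rightarrow> complex mat" where
  "proj n \<psi> = mat n n (\<lambda>(i, j). \<psi> $ i * cnj (\<psi> $ j))"

definition pure_decomps :: "nat \<Rightarrow> complex mat \<Rightarrow> (nat \<times> (nat \<Rightarrow> real) \<times> (nat \<Rightarrow> complex vec)) set" where
  "pure_decomps n \<rho> = {(m, p, \<psi>). (\<forall>k<m. p k \<ge> 0 \<and> unit_vec n (\<psi> k))
       \<and> \<rho> = mat n n (\<lambda>(i, j). \<Sum>k<m. complex_of_real (p k) * (proj n (\<psi> k) $$ (i, j)))}"

text \<open>Coherence of formation (minimum over decompositions, written as infimum).\<close>
definition coh_form :: "nat \<Rightarrow> complex mat \<Rightarrow> real" where
  "coh_form n \<rho> = Inf {\<Sum>k<m. p k * vN_entropy (dephase n (proj n (\<psi> k))) | m p \<psi>.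
                        (m, p, \<psi>) \<in> pure_decomps n \<rho>}"

text \<open>Bipartite system C^dA (x) C^dB, product basis |i>|j> is index i * dB + j.\<close>
definition ptrace_B :: "nat \<Rightarrow> nat \<Rightarrow> complex mat \<Rightarrow> complex mat" where
  "ptrace_B dA dB \<rho> = mat dA dA (\<lambda>(i, i'). \<Sum>j<dB. \<rho> $$ (i * dB + j, i' * dB + j))"

definition ptrace_A :: "nat \<Rightarrow> nat \<Rightarrow> complex mat \<Rightarrow> complex mat" where
  "ptrace_A dA dB \<rho> = mat dB dB (\<lambda>(j, j'). \<Sum>i<dA. \<rho> $$ (i * dB + j, i * dB + j'))"

definition ent_form :: "nat \<Rightarrow> nat \<Rightarrow> complex mat \<Rightarrow> real" where
  "ent_form dA dB \<rho> = Inf {\<Sum>k<m. p k * vN_entropy (ptrace_A dA dB (proj (dA * dB) (\<psi> k))) | m p \<psi>.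
                        (m, p, \<psi>) \<in> pure_decomps (dA * dB) \<rho>}"

end

theory Submission
  imports Defs "Jordan_Normal_Form.Schur_Decomposition"
begin

text \<open>For a pure bipartite state, measuring the first factor in the reference basis gives outcome \<open>i\<close>
  with probability \<open>q i\<close> and leaves the second factor pure, so the chain rule splits the entropy of the
  dephased state into $H(q)$ plus the average coherence of the pure remainders. Here $H(q)$ is the relative
  entropy of coherence of the first reduced state plus its entropy, which is the entanglement of the pure state.
  Averaging over a decomposition of a mixed state, the remainders decompose the second reduced state, and the
  claim follows from convexity of the relative entropy of coherence; the latter amounts to monotonicity
  of the relative entropy under dephasing.\<close>

section \<open>Unitary diagonalization of Hermitian matrices\<close>

text \<open>The obstacle is monotonicity: the two states compared need not share an eigenbasis with
  each other or with the reference basis, and the logarithm of a sum of matrices cannot be expanded.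
  So each relative entropy is recovered from a function of s on [0,1] whose derivative is (1 - s)
  d^2 / m, with d the difference of the arguments and m = b + s d their mixture. This trades the
  logarithm for a quadratic over a linear term, and d^2 / m is the supremum over x of 2 x d - x^2 m.
  On diagonal x the quantum form and the dephased form agree, since only diagonals of the states are
  seen there. No operator convexity enters. A second point is that entanglement is defined through
  one fixed factor, while the maximum needs both orientations. The two reductions of a pure state
  have equal entropy because \<open>A * B\<close> and \<open>B * A\<close> have the same nonzero
  spectrum with multiplicity.\<close>

definition dagger :: "complex mat \<Rightarrow> complex mat" where
  "dagger A = mat (dim_col A) (dim_row A) (\<lambda>(i, j). cnj (A $$ (j, i)))"

lemma dagger_index [simp]: "i < dim_col A \<Longrightarrow> j < dim_row A \<Longrightarrow> dagger A $$ (i, j) = cnj (A $$ (j, i))"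
  and dim_dagger [simp]: "dim_row (dagger A) = dim_col A" "dim_col (dagger A) = dim_row A"
  by (auto simp: dagger_def)

lemma dagger_carrier [simp]: "A \<in> carrier_mat m n \<Longrightarrow> dagger A \<in> carrier_mat n m"
  by (auto simp: dagger_def)

lemma dagger_dagger [simp]: "dagger (dagger A) = A"
  by (rule eq_matI) auto

lemma dagger_mult:
  assumes "A \<in> carrier_mat l m" "B \<in> carrier_mat m n"
  shows "dagger (A * B) = dagger B * dagger A"
  using assms by (intro eq_matI) (auto simp: scalar_prod_def mult.commute)

lemma dagger_four_block:
  assumes "A \<in> carrier_mat a a" "B \<in> carrier_mat a b" "C \<in> carrier_mat b a" "D \<in> carrier_mat b b"
  shows "dagger (four_block_mat A B C D) = four_block_mat (dagger A) (dagger C) (dagger B) (dagger D)"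
  using assms by (intro eq_matI) auto

text \<open>Gram-Schmidt applied to a basis completion of \<open>v\<close> keeps the head of the
  list, so after normalizing the columns the first one is still a multiple of \<open>v\<close>. The
  scalar is left open because only the direction matters for the deflation below.\<close>

lemma unitary_with_first_column:
  assumes v: "v \<in> carrier_vec n" and v0: "v \<noteq> 0\<^sub>v n" and n: "0 < n"
  obtains W c where "W \<in> carrier_mat n n" "dagger W * W = 1\<^sub>m n" "col W 0 = c \<cdot>\<^sub>v v"
proof -
  interpret cof_vec_space n "TYPE(complex)" .
  define b where "b = basis_completion v"
  define ws where "ws = gram_schmidt n b"
  from basis_completion[OF v v0, folded b_def]
  have dist_b: "distinct b" and indep: "\<not> lin_dep (set b)" and b: "set b \<subseteq> carrier_vec n"
    and hdb: "hd b = v" and len_b: "length b = n" by auto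
  from hdb len_b n obtain vs where bv: "b = v # vs" by (cases b) auto
  from gram_schmidt_result[OF b dist_b indep refl, folded ws_def]
  have ws: "set ws \<subseteq> carrier_vec n" "corthogonal ws" "length ws = n"
    by (auto simp: len_b)
  from gram_schmidt_hd[OF v, of vs, folded bv] have "hd ws = v" unfolding ws_def .
  with ws n have ws0: "ws ! 0 = v" by (cases ws) auto
  have wsc: "ws ! i \<in> carrier_vec n" if "i < n" for i using ws that by auto
  define N where "N j = sqrt (\<Sum>k<n. (cmod (ws ! j $ k))\<^sup>2)" for j
  define W where "W = mat n n (\<lambda>(i, j). ws ! j $ i / complex_of_real (N j))"
  have prod: "ws ! j \<bullet>c ws ! i = (\<Sum>k<n. cnj (ws ! i $ k) * ws ! j $ k)" if "i < n" "j < n" for i j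
    using wsc[OF that(1)] wsc[OF that(2)]
    by (auto simp: scalar_prod_def mult.commute lessThan_atLeast0 intro!: sum.cong)
  have NN: "complex_of_real (N i * N i) = (\<Sum>k<n. cnj (ws ! i $ k) * ws ! i $ k)" for i
  proof -
    have "N i * N i = (\<Sum>k<n. (cmod (ws ! i $ k))\<^sup>2)" by (simp add: N_def sum_nonneg)
    thus ?thesis by (simp only: of_real_sum complex_norm_square mult.commute)
  qed
  have N0: "N i \<noteq> 0" if i: "i < n" for i
    using NN[of i] prod[OF i i] corthogonalD[OF ws(2), of i i] i ws(3) by auto
  have "dagger W * W = 1\<^sub>m n"
  proof (rule eq_matI)
    fix i j assume "i < dim_row (1\<^sub>m n :: complex mat)" "j < dim_col (1\<^sub>m n :: complex mat)"
    hence i: "i < n" and j: "j < n" by auto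
    have "(dagger W * W) $$ (i, j) = (\<Sum>k<n. cnj (ws ! i $ k / N i) * (ws ! j $ k / N j))"
      using i j by (simp add: W_def scalar_prod_def lessThan_atLeast0)
    also have "\<dots> = (\<Sum>k<n. cnj (ws ! i $ k) * ws ! j $ k) / (N i * N j)"
      by (simp add: sum_divide_distrib)
    also have "\<dots> = 1\<^sub>m n $$ (i, j)"
      using i j N0[OF i] corthogonalD[OF ws(2), of j i] ws(3) prod[OF i j] NN[of i] by auto
    finally show "(dagger W * W) $$ (i, j) = 1\<^sub>m n $$ (i, j)" .
  qed (auto simp: W_def)
  moreover have "col W 0 = (1 / complex_of_real (N 0)) \<cdot>\<^sub>v v"
    using n v by (intro eq_vecI) (auto simp: W_def ws0)
  ultimately show ?thesis using that[of W "1 / complex_of_real (N 0)"] by (auto simp: W_def)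
qed

text \<open>Deflation: in an orthonormal basis starting with an eigenvector, the first column is
  \<open>e\<close> times the first unit vector, Hermiticity clears the first row too, and the
  remaining block \<open>B\<close> is Hermitian of size \<open>m\<close>. Bordering its diagonalizer
  \<open>V\<close> by a 1 and composing with \<open>W\<close> gives the unitary.\<close>

lemma unitary_diagonalization:
  assumes "A \<in> carrier_mat n n" "dagger A = A"
  shows "\<exists>U\<in>carrier_mat n n. dagger U * U = 1\<^sub>m n \<and> diagonal_mat (dagger U * A * U)"
  using assms
proof (induction n arbitrary: A)
  case 0
  then show ?case by (intro bexI[of _ "1\<^sub>m 0"]) (auto simp: diagonal_mat_def)
next
  case (Suc m A)
  let ?n = "Suc m"
  note A = Suc.prems(1)
  obtain as where as: "char_poly A = (\<Prod>a\<leftarrow>as. [:- a, 1:])" "length as = ?n"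
    using char_poly_factorized[OF A] by blast
  then obtain e where "poly (char_poly A) e = 0" by (cases as) auto
  then obtain v where "eigenvector A v e"
    using eigenvalue_root_char_poly[OF A] unfolding eigenvalue_def by blast
  hence v: "v \<in> carrier_vec ?n" and v0: "v \<noteq> 0\<^sub>v ?n" and ev: "A *\<^sub>v v = e \<cdot>\<^sub>v v"
    using A unfolding eigenvector_def by auto
  obtain W c where W: "W \<in> carrier_mat ?n ?n" and WW: "dagger W * W = 1\<^sub>m ?n" and c: "col W 0 = c \<cdot>\<^sub>v v"
    using unitary_with_first_column[OF v v0] by auto
  note W' = dagger_carrier[OF W]
  define A' where "A' = dagger W * A * W"
  have A': "A' \<in> carrier_mat ?n ?n" unfolding A'_def using A W W' by (intro mult_carrier_mat) auto
  have herm: "dagger A' = A'"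
    using A W W' Suc.prems(2)
    by (simp add: A'_def dagger_mult[of _ ?n ?n _ ?n] assoc_mult_mat[of _ ?n ?n _ ?n _ ?n] mult_carrier_mat[of _ ?n ?n _ ?n])
  have col0: "A' $$ (i, 0) = (if i = 0 then e else 0)" if i: "i < ?n" for i
  proof -
    have "A' = dagger W * (A * W)" unfolding A'_def by (rule assoc_mult_mat[OF W' A W])
    hence "A' $$ (i, 0) = row (dagger W) i \<bullet> col (A * W) 0"
      using i A W W' by simp
    also have "col (A * W) 0 = A *\<^sub>v col W 0" using A W by auto
    also have "\<dots> = e \<cdot>\<^sub>v col W 0"
      unfolding c using mult_mat_vec[OF A v, of c] ev v by (auto simp: smult_smult_assoc mult.commute)
    also have "row (dagger W) i \<bullet> (e \<cdot>\<^sub>v col W 0) = e * (row (dagger W) i \<bullet> col W 0)"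
      by (rule scalar_prod_smult_distrib[OF row_carrier_vec[OF i W'] col_carrier_vec[OF _ W]]) simp
    also have "row (dagger W) i \<bullet> col W 0 = (dagger W * W) $$ (i, 0)"
      using W W' i by simp
    finally show ?thesis using i by (simp add: WW)
  qed
  have row0: "A' $$ (0, i) = (if i = 0 then e else 0)" if i: "i < ?n" for i
    using col0[OF i] col0[of 0] arg_cong[OF herm, of "\<lambda>M. M $$ (0, i)"] A' i
    by (cases "i = 0") auto
  define B where "B = mat m m (\<lambda>(i, j). A' $$ (Suc i, Suc j))"
  have B: "B \<in> carrier_mat m m" by (simp add: B_def)
  have hermB: "dagger B = B"
  proof (rule eq_matI)
    fix i j assume "i < dim_row B" "j < dim_col B"
    thus "dagger B $$ (i, j) = B $$ (i, j)"
      using arg_cong[OF herm, of "\<lambda>M. M $$ (Suc i, Suc j)"] A' by (simp add: B_def)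
  qed (auto simp: B_def)
  obtain V where V: "V \<in> carrier_mat m m" and VV: "dagger V * V = 1\<^sub>m m"
    and diag: "diagonal_mat (dagger V * B * V)" using Suc.IH[OF B hermB] by blast
  note V' = dagger_carrier[OF V]
  let ?E = "mat 1 1 (\<lambda>_. e)"
  define P where "P = four_block_mat (1\<^sub>m 1) (0\<^sub>m 1 m) (0\<^sub>m m 1) V"
  have P: "P \<in> carrier_mat ?n ?n" unfolding P_def using V by auto
  have P'eq: "dagger P = four_block_mat (1\<^sub>m 1) (0\<^sub>m 1 m) (0\<^sub>m m 1) (dagger V)"
    unfolding P_def using V by (subst dagger_four_block[of _ 1 _ m]) (auto intro!: cong_four_block_mat)
  note P' = dagger_carrier[OF P]
  have A'eq: "A' = four_block_mat ?E (0\<^sub>m 1 m) (0\<^sub>m m 1) B"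
    using A' col0 row0 by (intro eq_matI) (auto simp: B_def)
  have PP: "dagger P * P = 1\<^sub>m ?n"
    unfolding P'eq unfolding P_def using V V' VV
    by (subst mult_four_block_mat[of _ 1 1 _ m _ m _ _ 1 _ m]) auto
  have "dagger P * A' = four_block_mat ?E (0\<^sub>m 1 m) (0\<^sub>m m 1) (dagger V * B)"
    unfolding P'eq A'eq using V V' B
    by (subst mult_four_block_mat[of _ 1 1 _ m _ m _ _ 1 _ m]) (auto)
  hence eq: "dagger P * A' * P = four_block_mat ?E (0\<^sub>m 1 m) (0\<^sub>m m 1) (dagger V * B * V)"
    unfolding P_def using V V' B
    by (simp, subst mult_four_block_mat[of _ 1 1 _ m _ m _ _ 1 _ m]) auto
  have dg: "diagonal_mat (dagger P * A' * P)"
  proof -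
    have "diagonal_mat (four_block_mat ?E (0\<^sub>m 1 m) (0\<^sub>m m 1) D)"
      if "diagonal_mat D" "D \<in> carrier_mat m m" for D
      using that unfolding diagonal_mat_def by auto
    moreover have "dagger V * B * V \<in> carrier_mat m m"
      using V V' B by (intro mult_carrier_mat) auto
    ultimately show ?thesis unfolding eq using diag by blast
  qed
  have e1: "dagger (W * P) = dagger P * dagger W" using W P by (simp add: dagger_mult)
  have "dagger (W * P) * (W * P) = dagger P * ((dagger W * W) * P)"
    unfolding e1 using W W' P P' by (simp add: assoc_mult_mat[of _ ?n ?n _ ?n _ ?n] mult_carrier_mat[of _ ?n ?n _ ?n])
  also have "\<dots> = 1\<^sub>m ?n" using P PP by (simp add: WW)
  finally have "dagger (W * P) * (W * P) = 1\<^sub>m ?n" .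
  moreover have "dagger (W * P) * A * (W * P) = dagger P * A' * P"
    unfolding e1 A'_def using A W W' P P' by (simp add: assoc_mult_mat[of _ ?n ?n _ ?n _ ?n] mult_carrier_mat[of _ ?n ?n _ ?n])
  ultimately show ?case using dg W P by (intro bexI[of _ "W * P"]) auto
qed

section \<open>Relative entropy and dephasing\<close>

text \<open>Stated for index functions, so that swapping the arguments yields the condition on
  columns and all identities stay plain finite sums.\<close>

definition orthonormal_rows :: "nat \<Rightarrow> (nat \<Rightarrow> nat \<Rightarrow> complex) \<Rightarrow> bool" where
  "orthonormal_rows n V \<longleftrightarrow> (\<forall>l<n. \<forall>l'<n. (\<Sum>j<n. V l j * cnj (V l' j)) = of_bool (l = l'))"

lemma orthonormal_rowsD:
  "orthonormal_rows n V \<Longrightarrow> l < n \<Longrightarrow> l' < n \<Longrightarrow> (\<Sum>j<n. V l j * cnj (V l' j)) = of_bool (l = l')"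
  by (simp add: orthonormal_rows_def)

lemma orthonormal_rows_cnj:
  assumes "orthonormal_rows n V"
  shows "orthonormal_rows n (\<lambda>l j. cnj (V l j))"
  unfolding orthonormal_rows_def
proof (intro allI impI)
  fix l l' assume "l < n" "l' < n"
  thus "(\<Sum>j<n. cnj (V l j) * cnj (cnj (V l' j))) = of_bool (l = l')"
    using orthonormal_rowsD[OF assms, of l' l] by (auto simp: mult.commute)
qed

lemma parseval:
  assumes "orthonormal_rows n V"
  shows "(\<Sum>j<n. cnj (\<Sum>l<n. c l * V l j) * (\<Sum>l<n. d l * V l j)) = (\<Sum>l<n. cnj (c l) * d l)"
proof -
  have "(\<Sum>j<n. cnj (\<Sum>l<n. c l * V l j) * (\<Sum>l<n. d l * V l j))
      = (\<Sum>j<n. \<Sum>l<n. \<Sum>l'<n. cnj (c l) * d l' * (V l' j * cnj (V l j)))"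
    unfolding cnj_sum sum_product by (intro sum.cong refl) simp
  also have "\<dots> = (\<Sum>l<n. \<Sum>j<n. \<Sum>l'<n. cnj (c l) * d l' * (V l' j * cnj (V l j)))"
    by (rule sum.swap)
  also have "\<dots> = (\<Sum>l<n. \<Sum>l'<n. \<Sum>j<n. cnj (c l) * d l' * (V l' j * cnj (V l j)))"
    by (intro sum.cong refl sum.swap)
  also have "\<dots> = (\<Sum>l<n. \<Sum>l'<n. cnj (c l) * d l' * of_bool (l' = l))"
    by (intro sum.cong refl) (simp add: orthonormal_rowsD[OF assms] flip: sum_distrib_left)
  also have "\<dots> = (\<Sum>l<n. cnj (c l) * d l)"
    by (intro sum.cong refl) (simp add: of_bool_def if_distrib cong: if_cong)
  finally show ?thesis .
qed

text \<open>With \<open>x\<close> read as a diagonal matrix X, this is the matrix element of X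
  between column \<open>i\<close> of \<open>U\<close> and column \<open>j\<close> of
  \<open>V\<close>; these columns will be the eigenvectors of the two states.\<close>

definition weighted_overlap ::
  "nat \<Rightarrow> (nat \<Rightarrow> nat \<Rightarrow> complex) \<Rightarrow> (nat \<Rightarrow> nat \<Rightarrow> complex) \<Rightarrow> (nat \<Rightarrow> real) \<Rightarrow> nat \<Rightarrow> nat \<Rightarrow> complex" where
  "weighted_overlap n U V x i j = (\<Sum>l<n. complex_of_real (x l) * cnj (U l i) * V l j)"

text \<open>Let A and B have the columns of \<open>U\<close> and \<open>V\<close> as eigenvectors,
  with eigenvalues \<alpha> and \<beta>. The left side is the real part of the trace of Y A X + Y X
  B, and for diagonal X and Y such a trace sees only the diagonals of A and B. This is how dephasing
  enters. In each part Parseval collapses one of the two outer sums.\<close>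

lemma sum_weighted_overlap:
  assumes U: "orthonormal_rows n U" and V: "orthonormal_rows n V"
  shows "(\<Sum>i<n. \<Sum>j<n. (\<alpha> i + \<beta> j) * Re (cnj (weighted_overlap n U V y i j) * weighted_overlap n U V x i j))
    = (\<Sum>l<n. y l * x l * ((\<Sum>i<n. \<alpha> i * (cmod (U l i))\<^sup>2) + (\<Sum>j<n. \<beta> j * (cmod (V l j))\<^sup>2)))"
    (is "?lhs = ?rhs")
proof -
  let ?W = "weighted_overlap n U V"
  have 1: "(\<Sum>j<n. Re (cnj (?W y i j) * ?W x i j)) = (\<Sum>l<n. y l * x l * (cmod (U l i))\<^sup>2)" for i
  proof -
    have "(\<Sum>j<n. cnj (?W y i j) * ?W x i j) = complex_of_real (\<Sum>l<n. y l * x l * (cmod (U l i))\<^sup>2)"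
    proof -
      have "?W x i j = (\<Sum>l<n. (x l * cnj (U l i)) * V l j)" for x j
        by (simp add: weighted_overlap_def mult_ac)
      hence "(\<Sum>j<n. cnj (?W y i j) * ?W x i j) = (\<Sum>l<n. cnj (y l * cnj (U l i)) * (x l * cnj (U l i)))"
        using parseval[OF V, of "\<lambda>l. y l * cnj (U l i)" "\<lambda>l. x l * cnj (U l i)"] by (simp only:)
      also have "\<dots> = complex_of_real (\<Sum>l<n. y l * x l * (cmod (U l i))\<^sup>2)"
        unfolding of_real_sum of_real_mult complex_norm_square by (intro sum.cong refl) simp
      finally show ?thesis .
    qed
    from arg_cong[OF this, of Re] show ?thesis by (simp only: Re_sum Re_complex_of_real)
  qed
  have 2: "(\<Sum>i<n. Re (cnj (?W y i j) * ?W x i j)) = (\<Sum>l<n. y l * x l * (cmod (V l j))\<^sup>2)" for j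
  proof -
    have "(\<Sum>i<n. cnj (?W y i j) * ?W x i j) = complex_of_real (\<Sum>l<n. y l * x l * (cmod (V l j))\<^sup>2)"
    proof -
      have "?W x i j = (\<Sum>l<n. (x l * V l j) * cnj (U l i))" for x i
        by (simp add: weighted_overlap_def mult_ac)
      hence "(\<Sum>i<n. cnj (?W y i j) * ?W x i j) = (\<Sum>l<n. cnj (y l * V l j) * (x l * V l j))"
        using parseval[OF orthonormal_rows_cnj[OF U], of "\<lambda>l. y l * V l j" "\<lambda>l. x l * V l j"] by (simp only:)
      also have "\<dots> = complex_of_real (\<Sum>l<n. y l * x l * (cmod (V l j))\<^sup>2)"
        unfolding of_real_sum of_real_mult complex_norm_square by (intro sum.cong refl) simp
      finally show ?thesis .
    qed
    from arg_cong[OF this, of Re] show ?thesis by (simp only: Re_sum Re_complex_of_real)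
  qed
  have "?lhs = (\<Sum>i<n. \<Sum>j<n. \<alpha> i * Re (cnj (?W y i j) * ?W x i j))
    + (\<Sum>i<n. \<Sum>j<n. \<beta> j * Re (cnj (?W y i j) * ?W x i j))"
    by (simp only: distrib_right sum.distrib)
  also have "(\<Sum>i<n. \<Sum>j<n. \<beta> j * Re (cnj (?W y i j) * ?W x i j))
    = (\<Sum>j<n. \<Sum>i<n. \<beta> j * Re (cnj (?W y i j) * ?W x i j))" by (rule sum.swap)
  also have "(\<Sum>j<n. \<Sum>i<n. \<beta> j * Re (cnj (?W y i j) * ?W x i j))
    = (\<Sum>j<n. \<beta> j * (\<Sum>l<n. y l * x l * (cmod (V l j))\<^sup>2))"
    by (simp only: 2 flip: sum_distrib_left)
  also have "\<dots> = (\<Sum>l<n. \<Sum>j<n. y l * x l * (\<beta> j * (cmod (V l j))\<^sup>2))"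
    unfolding sum_distrib_left by (subst sum.swap) (simp add: mult_ac)
  also have "(\<Sum>i<n. \<Sum>j<n. \<alpha> i * Re (cnj (?W y i j) * ?W x i j))
    = (\<Sum>i<n. \<alpha> i * (\<Sum>l<n. y l * x l * (cmod (U l i))\<^sup>2))"
    by (simp only: 1 flip: sum_distrib_left)
  also have "\<dots> = (\<Sum>l<n. \<Sum>i<n. y l * x l * (\<alpha> i * (cmod (U l i))\<^sup>2))"
    unfolding sum_distrib_left by (subst sum.swap) (simp add: mult_ac)
  finally show ?thesis by (simp add: sum_distrib_left distrib_left sum.distrib)
qed

text \<open>The increment from 0 to 1 is the scalar relative entropy
  \<open>a * (ln a - ln b)\<close> minus \<open>a - b\<close>. The linear correction makes the
  derivative a nonnegative multiple of a square over a linear term; the corrections cancel in the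
  final comparison.\<close>

definition rel_ent_path :: "real \<Rightarrow> real \<Rightarrow> real \<Rightarrow> real" where
  "rel_ent_path a b s = a * ln (b + s * (a - b)) - (a - b) * s"

lemma convex_comb_pos:
  fixes a b s :: real
  assumes "a \<ge> 0" "b \<ge> 0" "0 < s" "s < 1" "a \<noteq> 0 \<or> b \<noteq> 0"
  shows "b + s * (a - b) > 0"
proof -
  have "b + s * (a - b) = (1 - s) * b + s * a" by (simp add: algebra_simps)
  also have "\<dots> > 0"
    using assms by (cases "a = 0") (auto intro!: add_nonneg_pos)
  finally show ?thesis .
qed

lemma rel_ent_path_deriv:
  assumes "a \<ge> 0" "b \<ge> 0" "0 < s" "s < 1"
  shows "(rel_ent_path a b has_real_derivative (1 - s) * ((a - b)\<^sup>2 / (b + s * (a - b)))) (at s)"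
proof (cases "a = 0 \<and> b = 0")
  case True
  thus ?thesis by (simp add: rel_ent_path_def [abs_def])
next
  case False
  hence m: "b + s * (a - b) > 0" using convex_comb_pos assms by auto
  have "(rel_ent_path a b has_real_derivative a * ((a - b) / (b + s * (a - b))) - (a - b)) (at s)"
    unfolding rel_ent_path_def [abs_def] using m by (auto intro!: derivative_eq_intros)
  also have "a * ((a - b) / (b + s * (a - b))) - (a - b) = (1 - s) * ((a - b)\<^sup>2 / (b + s * (a - b)))"
    using m by (simp add: field_simps power2_eq_square)
  finally show ?thesis .
qed

text \<open>For \<open>b = 0 < a\<close> the logarithm diverges as \<open>s\<close> tends to 0,
  which the support condition rules out. For \<open>a = 0\<close> the logarithm has coefficient
  zero, so its singularity at \<open>s = 1\<close> is harmless.\<close>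

lemma rel_ent_path_cont:
  assumes "a \<ge> 0" "b \<ge> 0" "b = 0 \<Longrightarrow> a = 0"
  shows "continuous_on {0..1} (rel_ent_path a b)"
proof (cases "a = 0")
  case True
  thus ?thesis by (simp add: rel_ent_path_def [abs_def] continuous_intros)
next
  case False
  hence ab: "a > 0" "b > 0" using assms by (auto simp: less_le)
  have "b + s * (a - b) \<noteq> 0" if "s \<in> {0..1}" for s
  proof -
    have "b + s * (a - b) = (1 - s) * b + s * a" by (simp add: algebra_simps)
    also have "\<dots> > 0" using ab that
      by (cases "s = 0") (auto intro!: add_nonneg_pos)
    finally show ?thesis by simp
  qed
  thus ?thesis unfolding rel_ent_path_def [abs_def]
    by (auto intro!: continuous_intros)
qed

lemma Re_cnj_mult_self: "Re (cnj z * z) = (cmod z)\<^sup>2"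
  by (simp add: cmod_power2 flip: power2_eq_square)

text \<open>With m = b + s (a - b) > 0, expand the squared modulus of w (a - b) - x m and divide by
  m. Equality holds at x = w (a - b) / m, but \<open>x\<close> stays free so that matrix elements of
  a diagonal matrix can be inserted.\<close>

lemma quadratic_minorant:
  assumes "a \<ge> 0" "b \<ge> 0" "0 < s" "s < 1"
  shows "(cmod w)\<^sup>2 * ((a - b)\<^sup>2 / (b + s * (a - b)))
    \<ge> 2 * ((a - b) * Re (cnj w * x)) - (b + s * (a - b)) * (cmod x)\<^sup>2"
proof (cases "a = 0 \<and> b = 0")
  case False
  define m where "m = b + s * (a - b)"
  have m: "m > 0" unfolding m_def using False convex_comb_pos assms by auto
  have "0 \<le> (cmod (w * complex_of_real (a - b) - x * complex_of_real m))\<^sup>2" by simp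
  also have "\<dots> = (cmod w)\<^sup>2 * (a - b)\<^sup>2 - m * (2 * ((a - b) * Re (cnj w * x)) - m * (cmod x)\<^sup>2)"
    unfolding cmod_power2 by (simp add: power2_eq_square algebra_simps)
  finally show ?thesis unfolding m_def[symmetric] using m by (simp add: field_simps)
qed auto

text \<open>Monotonicity of the quantum relative entropy under dephasing, in spectral coordinates. The two
  relative entropies are the increments over $[0,1]$ of sums of \<^const>\<open>rel_ent_path\<close>, so it is enough
  to compare derivatives; there the quantum side is a supremum of a concave quadratic form over all matrices,
  and the dephased side is its value at a diagonal one.\<close>

lemma dephasing_decreases_relative_entropy:
  fixes a b :: "nat \<Rightarrow> real"
  assumes U: "orthonormal_rows n U" and V: "orthonormal_rows n V"
    and a: "\<And>i. i < n \<Longrightarrow> a i \<ge> 0" and b: "\<And>j. j < n \<Longrightarrow> b j \<ge> 0"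
  defines "w \<equiv> \<lambda>i j. (\<Sum>l<n. cnj (U l i) * V l j)"
    and "R \<equiv> \<lambda>l. (\<Sum>i<n. a i * (cmod (U l i))\<^sup>2)" and "S \<equiv> \<lambda>l. (\<Sum>j<n. b j * (cmod (V l j))\<^sup>2)"
  assumes supp: "\<And>i j. i < n \<Longrightarrow> j < n \<Longrightarrow> b j = 0 \<Longrightarrow> a i \<noteq> 0 \<Longrightarrow> w i j = 0"
    and supp': "\<And>l. l < n \<Longrightarrow> S l = 0 \<Longrightarrow> R l = 0"
  shows "(\<Sum>l<n. R l * (ln (R l) - ln (S l))) \<le> (\<Sum>i<n. \<Sum>j<n. (cmod (w i j))\<^sup>2 * (a i * (ln (a i) - ln (b j))))"
proof -
  let ?W = "weighted_overlap n U V"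
  have w: "w i j = ?W (\<lambda>_. 1) i j" for i j by (simp add: w_def weighted_overlap_def)
  have R: "R l \<ge> 0" and S: "S l \<ge> 0" for l using a b by (auto simp: R_def S_def intro!: sum_nonneg)
  define h where "h s = (\<Sum>i<n. \<Sum>j<n. (cmod (w i j))\<^sup>2 * rel_ent_path (a i) (b j) s)
    - (\<Sum>l<n. rel_ent_path (R l) (S l) s)" for s
  have cont: "continuous_on {0..1} h"
  proof -
    \<comment> \<open>A pair of eigenvalues with \<open>b j = 0\<close> and nonzero
      \<open>a i\<close> has overlap 0, so its discontinuous path carries no weight.\<close>
    have "continuous_on {0..1} (\<lambda>s. (cmod (w i j))\<^sup>2 * rel_ent_path (a i) (b j) s)"
      if "i < n" "j < n" for i j
      using supp[OF that] a[OF that(1)] b[OF that(2)]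
      by (cases "w i j = 0") (auto intro!: continuous_on_mult_left rel_ent_path_cont)
    moreover have "continuous_on {0..1} (rel_ent_path (R l) (S l))" if "l < n" for l
      using R S supp'[OF that] by (intro rel_ent_path_cont) auto
    ultimately show ?thesis unfolding h_def[abs_def]
      by (intro continuous_on_diff continuous_on_sum) auto
  qed
  have "h 0 \<le> h 1"
  proof (rule DERIV_nonneg_imp_increasing_open[of 0 1 h])
    fix s :: real assume s: "0 < s" "s < 1"
    define q where "q i j = (a i - b j)\<^sup>2 / (b j + s * (a i - b j))" for i j
    define r where "r l = (R l - S l)\<^sup>2 / (S l + s * (R l - S l))" for l
    let ?D = "(\<Sum>i<n. \<Sum>j<n. (cmod (w i j))\<^sup>2 * ((1 - s) * q i j)) - (\<Sum>l<n. (1 - s) * r l)"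
    have der: "(h has_real_derivative ?D) (at s)"
      unfolding h_def[abs_def] q_def r_def using a b R S s
      by (intro DERIV_diff DERIV_sum DERIV_cmult rel_ent_path_deriv) auto
    \<comment> \<open>The maximizer of the quadratic form for the dephased states; the same diagonal
      matrix then serves as trial matrix on the quantum side.\<close>
    define x where "x l = (R l - S l) / (S l + s * (R l - S l))" for l
    \<comment> \<open>The factor 1 prepares for \<open>sum_weighted_overlap\<close> with
      \<open>y\<close> constantly 1. For \<open>m = 0\<close> both sides vanish by the convention on
      division.\<close>
    have complete_square: "d\<^sup>2 / m = 2 * (1 * (d / m) * d) - d / m * (d / m) * m" for d m :: real
      by (cases "m = 0") (auto simp: field_simps power2_eq_square)
    \<comment> \<open>Difference and mixture of the diagonals are brought into the shape that
      \<open>sum_weighted_overlap\<close> produces, with weights \<open>a\<close>,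
      \<open>- b\<close> and \<open>s * a\<close>, \<open>(1 - s) * b\<close>.\<close>
    have A: "(\<Sum>i<n. a i * (cmod (U l i))\<^sup>2) + (\<Sum>j<n. - b j * (cmod (V l j))\<^sup>2) = R l - S l" for l
      by (simp add: R_def S_def sum_negf)
    have B: "(\<Sum>i<n. (s * a i) * (cmod (U l i))\<^sup>2) + (\<Sum>j<n. ((1 - s) * b j) * (cmod (V l j))\<^sup>2)
        = S l + s * (R l - S l)" for l
      by (simp only: mult.assoc flip: sum_distrib_left) (simp add: R_def S_def algebra_simps)
    have "(\<Sum>l<n. r l) = (\<Sum>l<n. 2 * (1 * x l * (R l - S l)) - x l * x l * (S l + s * (R l - S l)))"
      unfolding r_def x_def by (intro sum.cong refl complete_square)
    also have "\<dots> = 2 * (\<Sum>l<n. 1 * x l * ((\<Sum>i<n. a i * (cmod (U l i))\<^sup>2) + (\<Sum>j<n. - b j * (cmod (V l j))\<^sup>2)))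
      - (\<Sum>l<n. x l * x l * ((\<Sum>i<n. (s * a i) * (cmod (U l i))\<^sup>2) + (\<Sum>j<n. ((1 - s) * b j) * (cmod (V l j))\<^sup>2)))"
      by (simp only: A B) (simp add: sum_subtractf sum_distrib_left)
    also have "\<dots> = (\<Sum>i<n. \<Sum>j<n. 2 * ((a i - b j) * Re (cnj (w i j) * ?W x i j))
       - (b j + s * (a i - b j)) * (cmod (?W x i j))\<^sup>2)"
      unfolding sum_weighted_overlap[OF U V, symmetric] w[symmetric]
      unfolding Re_cnj_mult_self sum_distrib_left
      by (simp only: flip: sum_subtractf) (simp add: algebra_simps)
    also have "\<dots> \<le> (\<Sum>i<n. \<Sum>j<n. (cmod (w i j))\<^sup>2 * q i j)"
      unfolding q_def using a b s by (intro sum_mono quadratic_minorant) auto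
    finally have "0 \<le> (1 - s) * ((\<Sum>i<n. \<Sum>j<n. (cmod (w i j))\<^sup>2 * q i j) - (\<Sum>l<n. r l))"
      using s by simp
    also have "\<dots> = ?D" by (simp add: right_diff_distrib sum_distrib_left mult_ac)
    finally show "\<exists>y. (h has_real_derivative y) (at s) \<and> 0 \<le> y" using der by blast
  qed (use cont in auto)
  \<comment> \<open>The last bracket collects the linear corrections of the paths. It vanishes
    because both of its terms are the trace of the difference of the two operators.\<close>
  moreover have "h 1 - h 0 = (\<Sum>i<n. \<Sum>j<n. (cmod (w i j))\<^sup>2 * (a i * (ln (a i) - ln (b j))))
      - (\<Sum>l<n. R l * (ln (R l) - ln (S l)))
      - ((\<Sum>i<n. \<Sum>j<n. (a i + - b j) * Re (cnj (w i j) * w i j)) - (\<Sum>l<n. R l - S l))"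
    unfolding Re_cnj_mult_self
    by (simp add: h_def rel_ent_path_def sum_subtractf sum.distrib algebra_simps)
  moreover have "(\<Sum>i<n. \<Sum>j<n. (a i + - b j) * Re (cnj (w i j) * w i j)) = (\<Sum>l<n. R l - S l)"
    unfolding w sum_weighted_overlap[OF U V] by (simp add: R_def S_def sum_negf)
  ultimately show ?thesis by simp
qed

section \<open>Spectral form of the entropy and convexity of coherence\<close>

definition eta :: "real \<Rightarrow> real" where
  "eta x = - (x * log 2 x)"

lemma eta_ln: "eta x = - (x * ln x) / ln 2"
  by (simp add: eta_def log_def)

lemma eta_nonneg: "0 \<le> x \<Longrightarrow> x \<le> 1 \<Longrightarrow> 0 \<le> eta x"
  by (cases "x = 0") (auto simp: eta_def mult_nonneg_nonpos)

lemma eta_0 [simp]: "eta 0 = 0"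
  by (simp add: eta_def)

lemma proots_prod_linear: "proots (\<Prod>a\<leftarrow>as. [:- a, 1:]) = mset as" for as :: "complex list"
proof (induction as)
  case (Cons a as)
  have "(\<Prod>a\<leftarrow>as. [:- a, 1:]) \<noteq> (0 :: complex poly)" by (auto simp: prod_list_zero_iff)
  moreover have "[:- a, 1:] \<noteq> 0" by simp
  ultimately show ?case using Cons by (simp add: proots_mult del: mult_pCons_left)
qed simp

lemma vN_entropy_char_poly:
  "vN_entropy A = sum_mset (image_mset (\<lambda>x. eta (Re x)) (proots (char_poly A)))"
  by (simp add: vN_entropy_def eta_def)

lemma vN_entropy_diagonal:
  assumes A: "A \<in> carrier_mat n n" and diag: "diagonal_mat A"
  shows "vN_entropy A = (\<Sum>i<n. eta (Re (A $$ (i, i))))"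
proof -
  have "upper_triangular A" using A diag by (auto simp: diagonal_mat_def upper_triangular_def)
  hence "vN_entropy A = (\<Sum>i\<leftarrow>[0..<n]. eta (Re (A $$ (i, i))))"
    using A unfolding vN_entropy_char_poly char_poly_upper_triangular[OF A \<open>upper_triangular A\<close>]
      proots_prod_linear mset_map[symmetric] sum_mset_sum_list by (simp add: diag_mat_def comp_def)
  thus ?thesis by (simp add: interv_sum_list_conv_sum_set_nat lessThan_atLeast0)
qed

lemma vN_entropy_dephase: "vN_entropy (dephase n A) = (\<Sum>i<n. eta (Re (A $$ (i, i))))"
  by (subst vN_entropy_diagonal[of _ n]) (auto simp: dephase_def diagonal_mat_def)

text \<open>The columns of \<open>U\<close> are the eigenvectors, and orthonormality is recorded for
  rows and columns alike. The entropy clause ties \<open>d\<close> to the characteristic polynomial,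
  from which the entropy is defined.\<close>

definition spectral :: "nat \<Rightarrow> complex mat \<Rightarrow> (nat \<Rightarrow> nat \<Rightarrow> complex) \<Rightarrow> (nat \<Rightarrow> real) \<Rightarrow> bool" where
  "spectral n A U d \<longleftrightarrow> orthonormal_rows n U \<and> orthonormal_rows n (\<lambda>i l. U l i)
    \<and> (\<forall>i<n. \<forall>j<n. A $$ (i, j) = (\<Sum>r<n. complex_of_real (d r) * (U i r * cnj (U j r))))
    \<and> vN_entropy A = (\<Sum>i<n. eta (d i))"

text \<open>Similarity to the diagonal matrix \<open>D\<close> preserves the characteristic
  polynomial and with it the entropy; \<open>D\<close> is again Hermitian, so taking
  \<open>Re\<close> of its diagonal loses nothing.\<close>

lemma spectral_exists:
  assumes A: "A \<in> carrier_mat n n" and herm: "dagger A = A"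
  shows "\<exists>U d. spectral n A U d"
proof -
  obtain U where U: "U \<in> carrier_mat n n" and UU: "dagger U * U = 1\<^sub>m n"
    and diag: "diagonal_mat (dagger U * A * U)"
    using unitary_diagonalization[OF A herm] by blast
  note U' = dagger_carrier[OF U]
  note assoc = assoc_mult_mat[of _ n n _ n _ n] mult_carrier_mat[of _ n n _ n]
  have UU': "U * dagger U = 1\<^sub>m n" using mat_mult_left_right_inverse[OF U' U UU] .
  define D where "D = dagger U * A * U"
  have D: "D \<in> carrier_mat n n" using U U' A by (simp add: D_def assoc)
  have herm_D: "dagger D = D"
    using A U U' herm by (simp add: D_def dagger_mult[of _ n n _ n] assoc)
  have D_real: "D $$ (i, i) = complex_of_real (Re (D $$ (i, i)))" if "i < n" for i
  proof -
    have "cnj (D $$ (i, i)) = D $$ (i, i)"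
      using dagger_index[of i D i] herm_D that D by simp
    thus ?thesis by (simp add: complex_eq_iff)
  qed
  have D0: "D $$ (i, j) = 0" if "i < n" "j < n" "i \<noteq> j" for i j
    using diag D that unfolding D_def[symmetric] diagonal_mat_def by auto
  have "U * D * dagger U = (U * dagger U) * A * (U * dagger U)"
    using A U U' by (simp add: D_def assoc)
  hence A_eq: "A = U * D * dagger U" using A by (simp add: UU')
  have "similar_mat_wit A D U (dagger U)"
    by (rule similar_mat_witI[OF UU' UU A_eq A D U U'])
  hence cp: "char_poly A = char_poly D" using char_poly_similar by (auto simp: similar_mat_def)
  have "vN_entropy A = (\<Sum>i<n. eta (Re (D $$ (i, i))))"
    using vN_entropy_diagonal[OF D] diag by (simp add: D_def[symmetric] vN_entropy_def cp)
  moreover have "A $$ (i, j) = (\<Sum>r<n. complex_of_real (Re (D $$ (r, r))) * (U $$ (i, r) * cnj (U $$ (j, r))))"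
    if ij: "i < n" "j < n" for i j
  proof -
    have UD: "(U * D) $$ (i, r) = U $$ (i, r) * D $$ (r, r)" if r: "r < n" for r
    proof -
      have "(U * D) $$ (i, r) = (\<Sum>k<n. U $$ (i, k) * D $$ (k, r))"
        using U D ij r by (simp add: scalar_prod_def lessThan_atLeast0)
      also have "\<dots> = (\<Sum>k<n. if k = r then U $$ (i, r) * D $$ (r, r) else 0)"
        using D0 r by (intro sum.cong) auto
      finally show ?thesis using r by simp
    qed
    have prod: "(X * dagger U) $$ (i, j) = (\<Sum>r<n. X $$ (i, r) * dagger U $$ (r, j))"
      if "X \<in> carrier_mat n n" for X
      using that U ij by (simp add: scalar_prod_def lessThan_atLeast0)
    have UDc: "U * D \<in> carrier_mat n n" using U D by (rule mult_carrier_mat)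
    have "A $$ (i, j) = (\<Sum>r<n. (U * D) $$ (i, r) * dagger U $$ (r, j))"
      unfolding A_eq by (rule prod[OF UDc])
    also have "\<dots> = (\<Sum>r<n. complex_of_real (Re (D $$ (r, r))) * (U $$ (i, r) * cnj (U $$ (j, r))))"
      using U ij by (intro sum.cong refl) (simp add: UD D_real[symmetric])
    finally show ?thesis .
  qed
  moreover have "orthonormal_rows n (\<lambda>i l. U $$ (i, l))"
    unfolding orthonormal_rows_def
  proof (intro allI impI)
    fix i j assume ij: "i < n" "j < n"
    have "(\<Sum>r<n. U $$ (i, r) * cnj (U $$ (j, r))) = (U * dagger U) $$ (i, j)"
      using U ij by (simp add: scalar_prod_def lessThan_atLeast0)
    thus "(\<Sum>r<n. U $$ (i, r) * cnj (U $$ (j, r))) = of_bool (i = j)" using ij by (simp add: UU')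
  qed
  moreover have "orthonormal_rows n (\<lambda>i l. U $$ (l, i))"
    unfolding orthonormal_rows_def
  proof (intro allI impI)
    fix i j assume ij: "i < n" "j < n"
    have "(\<Sum>r<n. U $$ (r, i) * cnj (U $$ (r, j))) = (dagger U * U) $$ (j, i)"
      using U ij by (simp add: scalar_prod_def lessThan_atLeast0 mult.commute)
    thus "(\<Sum>r<n. U $$ (r, i) * cnj (U $$ (r, j))) = of_bool (i = j)" using ij by (simp add: UU)
  qed
  ultimately have "spectral n A (\<lambda>i j. U $$ (i, j)) (\<lambda>i. Re (D $$ (i, i)))"
    unfolding spectral_def by blast
  thus ?thesis by blast
qed

section \<open>Quadratic forms and positive semidefinite matrices\<close>

definition qform :: "nat \<Rightarrow> complex mat \<Rightarrow> (nat \<Rightarrow> complex) \<Rightarrow> complex" where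
  "qform n A v = (\<Sum>i<n. \<Sum>j<n. cnj (v i) * A $$ (i, j) * v j)"

text \<open>Each rank-one term contributes one squared modulus. The index set is arbitrary, which
  covers both eigendecompositions and mixtures of vectors indexed by pairs.\<close>

lemma qform_gram:
  assumes "\<And>i j. i < n \<Longrightarrow> j < n \<Longrightarrow> A $$ (i, j) = (\<Sum>r\<in>I. complex_of_real (c r) * (f r i * cnj (f r j)))"
  shows "qform n A v = complex_of_real (\<Sum>r\<in>I. c r * (cmod (\<Sum>i<n. cnj (v i) * f r i))\<^sup>2)"
proof -
  have "qform n A v = (\<Sum>i<n. \<Sum>j<n. \<Sum>r\<in>I. complex_of_real (c r) * ((cnj (v i) * f r i) * cnj (cnj (v j) * f r j)))"
    by (simp add: qform_def assms sum_distrib_left sum_distrib_right mult_ac)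
  also have "\<dots> = (\<Sum>i<n. \<Sum>r\<in>I. \<Sum>j<n. complex_of_real (c r) * ((cnj (v i) * f r i) * cnj (cnj (v j) * f r j)))"
    by (intro sum.cong refl sum.swap)
  also have "\<dots> = (\<Sum>r\<in>I. \<Sum>i<n. \<Sum>j<n. complex_of_real (c r) * ((cnj (v i) * f r i) * cnj (cnj (v j) * f r j)))"
    by (rule sum.swap)
  also have "\<dots> = (\<Sum>r\<in>I. complex_of_real (c r) * ((\<Sum>i<n. cnj (v i) * f r i) * cnj (\<Sum>i<n. cnj (v i) * f r i)))"
    unfolding cnj_sum sum_product by (simp only: sum_distrib_left)
  finally show ?thesis unfolding of_real_sum of_real_mult complex_norm_square .
qed

definition psd :: "nat \<Rightarrow> complex mat \<Rightarrow> bool" where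
  "psd n A \<longleftrightarrow> A \<in> carrier_mat n n \<and> dagger A = A \<and> (\<forall>v. 0 \<le> Re (qform n A v))"

lemma psd_gram:
  assumes "A \<in> carrier_mat n n"
    and eq: "\<And>i j. i < n \<Longrightarrow> j < n \<Longrightarrow> A $$ (i, j) = (\<Sum>r\<in>I. complex_of_real (c r) * (f r i * cnj (f r j)))"
    and c: "\<And>r. r \<in> I \<Longrightarrow> 0 \<le> c r"
  shows "psd n A"
  unfolding psd_def
proof (intro conjI allI)
  show "dagger A = A" using assms(1) by (intro eq_matI) (auto simp: eq mult.commute)
  show "0 \<le> Re (qform n A v)" for v
    using c by (simp add: qform_gram[OF eq] sum_nonneg)
qed fact

lemma qform_spectral:
  assumes "spectral n A U d"
  shows "qform n A v = complex_of_real (\<Sum>r<n. d r * (cmod (\<Sum>i<n. cnj (v i) * U i r))\<^sup>2)"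
  using assms unfolding spectral_def by (intro qform_gram[where f = "\<lambda>r i. U i r"]) auto

lemma qform_eigenvector:
  assumes sp: "spectral n A U d" and j: "j < n"
  shows "qform n A (\<lambda>l. U l j) = complex_of_real (d j)"
proof -
  have "(\<Sum>i<n. cnj (U i j) * U i r) = of_bool (r = j)" if "r < n" for r
    using orthonormal_rowsD[of n "\<lambda>i l. U l i" r j] sp j that
    by (simp add: spectral_def mult.commute)
  hence "qform n A (\<lambda>l. U l j) = complex_of_real (\<Sum>r<n. if r = j then d j else 0)"
    unfolding qform_spectral[OF sp] by (intro arg_cong[of _ _ complex_of_real] sum.cong) auto
  thus ?thesis using j by simp
qed

lemma psd_spectral:
  assumes "psd n A"
  shows "\<exists>U d. spectral n A U d \<and> (\<forall>i<n. 0 \<le> d i)"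
proof -
  from assms obtain U d where sp: "spectral n A U d" using spectral_exists unfolding psd_def by blast
  have "0 \<le> d i" if "i < n" for i
    using assms qform_eigenvector[OF sp that] unfolding psd_def by (metis Re_complex_of_real)
  with sp show ?thesis by blast
qed

lemma spectral_diag:
  assumes "spectral n A U d" "l < n"
  shows "Re (A $$ (l, l)) = (\<Sum>r<n. d r * (cmod (U l r))\<^sup>2)"
proof -
  have "A $$ (l, l) = complex_of_real (\<Sum>r<n. d r * (cmod (U l r))\<^sup>2)"
    using assms unfolding spectral_def of_real_sum of_real_mult complex_norm_square by auto
  thus ?thesis by simp
qed

lemma rel_coh_spectral:
  assumes "spectral n A U d"
  shows "rel_coh n A = ((\<Sum>i<n. d i * ln (d i)) - (\<Sum>l<n. Re (A $$ (l, l)) * ln (Re (A $$ (l, l))))) / ln 2"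
proof -
  have "rel_coh n A = (\<Sum>i<n. eta (Re (A $$ (i, i)))) - (\<Sum>i<n. eta (d i))"
    using assms by (simp add: rel_coh_def vN_entropy_dephase spectral_def)
  thus ?thesis by (simp add: eta_ln sum_negf diff_divide_distrib flip: sum_divide_distrib)
qed

text \<open>Write D for the relative entropy. Since \<open>S\<close> is the mixture of the
  \<open>R k\<close>, the terms containing logarithms of \<open>S\<close> average out, and the right
  side minus the left is the sum over \<open>k\<close> of \<open>p k\<close> times D(R k || S) -
  D(\<Delta> R k || \<Delta> S), up to the factor \<open>ln 2\<close>. Each bracket with positive
  weight is nonnegative by monotonicity.\<close>

lemma rel_coh_convex:
  fixes m :: nat
  assumes R: "\<And>k. k < m \<Longrightarrow> psd n (R k)" and p: "\<And>k. k < m \<Longrightarrow> 0 \<le> p k"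
    and S: "psd n S" and S_eq: "\<And>i j. i < n \<Longrightarrow> j < n \<Longrightarrow> S $$ (i, j) = (\<Sum>k<m. complex_of_real (p k) * R k $$ (i, j))"
  shows "rel_coh n S \<le> (\<Sum>k<m. p k * rel_coh n (R k))"
proof -
  obtain V b where spS: "spectral n S V b" and b: "\<And>j. j < n \<Longrightarrow> 0 \<le> b j"
    using psd_spectral[OF S] by blast
  obtain U a where spR: "\<And>k. k < m \<Longrightarrow> spectral n (R k) (U k) (a k)"
    and a: "\<And>k i. k < m \<Longrightarrow> i < n \<Longrightarrow> 0 \<le> a k i"
    using psd_spectral[OF R] by metis
  define w where "w k i j = (\<Sum>l<n. cnj (U k l i) * V l j)" for k i j
  \<comment> \<open>The diagonal of \<open>R k\<close> in the eigenbasis of \<open>S\<close>;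
    averaging with \<open>p\<close> returns the eigenvalues of \<open>S\<close>.\<close>
  define \<beta> where "\<beta> k j = (\<Sum>i<n. a k i * (cmod (w k i j))\<^sup>2)" for k j
  define r where "r k l = Re (R k $$ (l, l))" for k l
  define s where "s l = Re (S $$ (l, l))" for l
  have V: "orthonormal_rows n V" using spS by (simp add: spectral_def)
  have r_eq: "r k l = (\<Sum>i<n. a k i * (cmod (U k l i))\<^sup>2)" if "k < m" "l < n" for k l
    using spectral_diag[OF spR[OF that(1)] that(2)] by (simp add: r_def)
  have s_eq: "s l = (\<Sum>j<n. b j * (cmod (V l j))\<^sup>2)" if "l < n" for l
    using spectral_diag[OF spS that] by (simp add: s_def)
  have r_nonneg: "0 \<le> r k l" if "k < m" "l < n" for k l
    using r_eq[OF that] a[OF that(1)] by (auto intro!: sum_nonneg)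
  have s_sum: "s l = (\<Sum>k<m. p k * r k l)" if "l < n" for l
    using S_eq[OF that that] by (simp add: s_def r_def)
  have \<beta>_nonneg: "0 \<le> \<beta> k j" if "k < m" for k j
    using a[OF that] by (auto simp: \<beta>_def intro!: sum_nonneg)
  have b_sum: "b j = (\<Sum>k<m. p k * \<beta> k j)" if j: "j < n" for j
  proof -
    have cm: "cmod (\<Sum>l<n. cnj (V l j) * U k l i) = cmod (w k i j)" for k i
    proof -
      have "(\<Sum>l<n. cnj (V l j) * U k l i) = cnj (w k i j)" by (simp add: w_def mult.commute)
      thus ?thesis by simp
    qed
    have "complex_of_real (b j) = qform n S (\<lambda>l. V l j)" using qform_eigenvector[OF spS j] by simp
    also have "\<dots> = (\<Sum>i<n. \<Sum>i'<n. \<Sum>k<m. p k * (cnj (V i j) * R k $$ (i, i') * V i' j))"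
      unfolding qform_def by (intro sum.cong refl) (simp add: S_eq sum_distrib_left sum_distrib_right mult_ac)
    also have "\<dots> = (\<Sum>i<n. \<Sum>k<m. \<Sum>i'<n. p k * (cnj (V i j) * R k $$ (i, i') * V i' j))"
      by (intro sum.cong refl sum.swap)
    also have "\<dots> = (\<Sum>k<m. \<Sum>i<n. \<Sum>i'<n. p k * (cnj (V i j) * R k $$ (i, i') * V i' j))"
      by (rule sum.swap)
    also have "\<dots> = (\<Sum>k<m. p k * qform n (R k) (\<lambda>l. V l j))"
      by (simp add: qform_def sum_distrib_left)
    also have "\<dots> = complex_of_real (\<Sum>k<m. p k * \<beta> k j)"
      using qform_spectral[OF spR] by (simp add: \<beta>_def cm)
    finally show ?thesis by (simp only: of_real_eq_iff)
  qed
  have key: "p k * (\<Sum>l<n. r k l * (ln (r k l) - ln (s l)))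
      \<le> p k * ((\<Sum>i<n. a k i * ln (a k i)) - (\<Sum>j<n. ln (b j) * \<beta> k j))" if k: "k < m" for k
  proof (cases "p k = 0")
    case False
    hence pk: "0 < p k" using p[OF k] by simp
    have U: "orthonormal_rows n (U k)" using spR[OF k] by (simp add: spectral_def)
    \<comment> \<open>A zero eigenvalue of \<open>S\<close> is a sum of nonnegative terms
      \<open>p k * \<beta> k j\<close>, so for \<open>p k > 0\<close> the corresponding eigenvector
      of \<open>S\<close> also lies in the kernel of \<open>R k\<close>.\<close>
    have supp: "w k i j = 0" if ij: "i < n" "j < n" "b j = 0" "a k i \<noteq> 0" for i j
    proof -
      have "p k * \<beta> k j = 0"
        using b_sum[OF ij(2)] ij(3) k p \<beta>_nonneg by (intro sum_nonneg_0[of "{..<m}" "\<lambda>k. p k * \<beta> k j"]) auto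
      hence "\<beta> k j = 0" using pk by simp
      hence "a k i * (cmod (w k i j))\<^sup>2 = 0"
        using ij(1) a[OF k] unfolding \<beta>_def
        by (intro sum_nonneg_0[of "{..<n}" "\<lambda>i. a k i * (cmod (w k i j))\<^sup>2"]) auto
      thus ?thesis using ij(4) by simp
    qed
    have supp': "r k l = 0" if l: "l < n" "s l = 0" for l
    proof -
      have "p k * r k l = 0"
        using s_sum[OF l(1)] l k p r_nonneg by (intro sum_nonneg_0[of "{..<m}" "\<lambda>k. p k * r k l"]) auto
      thus ?thesis using pk by simp
    qed
    have "(\<Sum>l<n. r k l * (ln (r k l) - ln (s l)))
        \<le> (\<Sum>i<n. \<Sum>j<n. (cmod (w k i j))\<^sup>2 * (a k i * (ln (a k i) - ln (b j))))"
      using dephasing_decreases_relative_entropy[OF U V, of "a k" b] a[OF k] b supp supp' k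
      by (simp add: w_def r_eq s_eq)
    also have "\<dots> = (\<Sum>i<n. \<Sum>j<n. (cmod (w k i j))\<^sup>2 * (a k i * ln (a k i)))
        - (\<Sum>i<n. \<Sum>j<n. ln (b j) * (a k i * (cmod (w k i j))\<^sup>2))"
      by (simp add: sum_subtractf algebra_simps)
    also have "(\<Sum>i<n. \<Sum>j<n. ln (b j) * (a k i * (cmod (w k i j))\<^sup>2)) = (\<Sum>j<n. ln (b j) * \<beta> k j)"
      unfolding \<beta>_def sum_distrib_left by (rule sum.swap)
    also have "(\<Sum>i<n. \<Sum>j<n. (cmod (w k i j))\<^sup>2 * (a k i * ln (a k i))) = (\<Sum>i<n. a k i * ln (a k i))"
    proof (intro sum.cong refl)
      fix i assume "i \<in> {..<n}"
      hence i: "i < n" by simp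
      \<comment> \<open>The overlaps are the coefficients, up to conjugation, of a unit eigenvector
        of \<open>R k\<close> in the eigenbasis of \<open>S\<close>.\<close>
      have "complex_of_real (\<Sum>j<n. (cmod (w k i j))\<^sup>2) = (\<Sum>l<n. cnj (cnj (U k l i)) * cnj (U k l i))"
        unfolding of_real_sum complex_norm_square w_def
        using parseval[OF V, of "\<lambda>l. cnj (U k l i)" "\<lambda>l. cnj (U k l i)"] by (simp only: mult.commute)
      also have "\<dots> = 1"
        using orthonormal_rowsD[of n "\<lambda>i l. U k l i" i i] spR[OF k] i by (simp add: spectral_def)
      finally have "(\<Sum>j<n. (cmod (w k i j))\<^sup>2) = 1" by (simp only: of_real_eq_1_iff)
      thus "(\<Sum>j<n. (cmod (w k i j))\<^sup>2 * (a k i * ln (a k i))) = a k i * ln (a k i)"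
        by (simp flip: sum_distrib_right)
    qed
    finally show ?thesis using pk by simp
  qed simp
  have "(\<Sum>k<m. p k * (\<Sum>l<n. r k l * ln (r k l))) - (\<Sum>l<n. s l * ln (s l))
      = (\<Sum>k<m. p k * (\<Sum>l<n. r k l * (ln (r k l) - ln (s l))))"
  proof -
    have "(\<Sum>l<n. s l * ln (s l)) = (\<Sum>l<n. \<Sum>k<m. p k * (r k l * ln (s l)))"
      by (intro sum.cong refl) (simp add: s_sum[symmetric] sum_distrib_right[symmetric] mult.assoc[symmetric])
    also have "\<dots> = (\<Sum>k<m. p k * (\<Sum>l<n. r k l * ln (s l)))"
      by (subst sum.swap) (simp add: sum_distrib_left)
    finally show ?thesis by (simp add: right_diff_distrib sum_subtractf)
  qed
  also have "\<dots> \<le> (\<Sum>k<m. p k * ((\<Sum>i<n. a k i * ln (a k i)) - (\<Sum>j<n. ln (b j) * \<beta> k j)))"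
    by (intro sum_mono key) simp
  also have "\<dots> = (\<Sum>k<m. p k * (\<Sum>i<n. a k i * ln (a k i))) - (\<Sum>j<n. b j * ln (b j))"
  proof -
    have "(\<Sum>j<n. b j * ln (b j)) = (\<Sum>j<n. \<Sum>k<m. p k * (ln (b j) * \<beta> k j))"
    proof (intro sum.cong refl)
      fix j assume "j \<in> {..<n}"
      hence "b j * ln (b j) = ln (b j) * (\<Sum>k<m. p k * \<beta> k j)" by (simp flip: b_sum)
      thus "b j * ln (b j) = (\<Sum>k<m. p k * (ln (b j) * \<beta> k j))"
        by (simp only: sum_distrib_left mult.left_commute)
    qed
    also have "\<dots> = (\<Sum>k<m. p k * (\<Sum>j<n. ln (b j) * \<beta> k j))"
      by (subst sum.swap) (simp add: sum_distrib_left)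
    finally show ?thesis by (simp add: right_diff_distrib sum_subtractf)
  qed
  finally have "((\<Sum>j<n. b j * ln (b j)) - (\<Sum>l<n. s l * ln (s l))) / ln 2
    \<le> (\<Sum>k<m. p k * ((\<Sum>i<n. a k i * ln (a k i)) - (\<Sum>l<n. r k l * ln (r k l)))) / ln 2"
    by (intro divide_right_mono) (simp_all add: right_diff_distrib sum_subtractf)
  thus ?thesis
    using rel_coh_spectral[OF spS] rel_coh_spectral[OF spR]
    by (simp add: r_def s_def sum_divide_distrib)
qed

text \<open>Conjugation by the unipotent block matrix \<open>P\<close> makes \<open>X\<close>, with
  diagonal blocks \<open>A * B\<close> and 0, similar to \<open>Y\<close>, with diagonal blocks 0
  and \<open>B * A\<close>. The characteristic polynomials therefore differ only by powers of the
  variable, and zero eigenvalues contribute \<open>eta 0 = 0\<close>.\<close>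

lemma vN_entropy_mult_commute:
  assumes A: "A \<in> carrier_mat m n" and B: "B \<in> carrier_mat n m"
  shows "vN_entropy (A * B) = vN_entropy (B * A)"
proof -
  define H where "H p = sum_mset (image_mset (\<lambda>x. eta (Re x)) (proots p))" for p
  have H: "vN_entropy M = H (char_poly M)" for M by (simp add: H_def vN_entropy_char_poly)
  have H_mult: "H (p * q) = H p + H q" if "p \<noteq> 0" "q \<noteq> 0" for p q
    using that by (simp add: H_def proots_mult)
  have H_zero: "H (char_poly (0\<^sub>m k k)) = 0" for k
    unfolding H[symmetric] by (subst vN_entropy_diagonal[of _ k]) (auto simp: diagonal_mat_def)
  have nz: "char_poly M \<noteq> 0" if "M \<in> carrier_mat k k" for M :: "complex mat" and k
    using degree_monic_char_poly[OF that] by auto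
  have fact: "\<exists>es. char_poly M = (\<Prod>a\<leftarrow>es. [:- a, 1:])" if "M \<in> carrier_mat k k" for M :: "complex mat" and k
    using char_poly_factorized[OF that] by blast
  have AB: "A * B \<in> carrier_mat m m" and BA: "B * A \<in> carrier_mat n n" using A B by auto
  define X where "X = four_block_mat (A * B) (0\<^sub>m m n) B (0\<^sub>m n n)"
  define Y where "Y = four_block_mat (0\<^sub>m m m) (0\<^sub>m m n) B (B * A)"
  define P where "P = four_block_mat (1\<^sub>m m) A (0\<^sub>m n m) (1\<^sub>m n)"
  define Q where "Q = four_block_mat (1\<^sub>m m) (- A) (0\<^sub>m n m) (1\<^sub>m n)"
  have [simp]: "- 0\<^sub>m n n + 1\<^sub>m n = (1\<^sub>m n :: complex mat)" by (intro eq_matI) auto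
  have [simp]: "A + - A = 0\<^sub>m m n" using A by (intro eq_matI) auto
  have PQ: "P * Q = 1\<^sub>m (m + n)" unfolding P_def Q_def
    using A by (subst mult_four_block_mat[of _ m m _ n _ n _ _ m _ n]) auto
  have QP: "Q * P = 1\<^sub>m (m + n)" unfolding P_def Q_def
    using A by (subst mult_four_block_mat[of _ m m _ n _ n _ _ m _ n]) auto
  have PY: "P * Y = four_block_mat (A * B) (A * (B * A)) B (B * A)" unfolding P_def Y_def
    using A B AB BA by (subst mult_four_block_mat[of _ m m _ n _ n _ _ m _ n]) auto
  have ABA: "A * B * - A + A * (B * A) = 0\<^sub>m m n"
    using A B AB BA by (simp add: assoc_mult_mat[OF A B A] uminus_l_inv_mat[of _ m n])
  have BA': "B * - A + B * A = 0\<^sub>m n n"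
    using A B BA by (simp add: uminus_l_inv_mat[of _ n n])
  have "X = P * Y * Q" unfolding PY unfolding X_def Q_def
    using A B AB BA by (subst mult_four_block_mat[of _ m m _ n _ n _ _ m _ n]) (auto simp: ABA BA')
  hence "similar_mat_wit X Y P Q"
    using A B AB BA PQ QP
    by (intro similar_mat_witI[of _ _ "m + n"]) (auto simp: X_def Y_def P_def Q_def)
  hence "char_poly X = char_poly Y" using char_poly_similar by (auto simp: similar_mat_def)
  moreover have "char_poly X = char_poly (A * B) * char_poly (0\<^sub>m n n)"
    by (rule char_poly_0_block'[OF X_def fact[OF AB] fact[OF zero_carrier_mat] AB B zero_carrier_mat])
  moreover have "char_poly Y = char_poly (0\<^sub>m m m) * char_poly (B * A)"
    by (rule char_poly_0_block'[OF Y_def fact[OF zero_carrier_mat] fact[OF BA] zero_carrier_mat B BA])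
  ultimately have "H (char_poly (A * B) * char_poly (0\<^sub>m n n)) = H (char_poly (0\<^sub>m m m) * char_poly (B * A))"
    by simp
  thus ?thesis
    using nz[OF AB] nz[OF BA] nz[OF zero_carrier_mat] by (simp add: H H_mult H_zero)
qed

text \<open>Eigenvalues are nonnegative with sum 1, hence at most 1. This supplies the lower bound
  that makes the infimum in \<open>ent_form\<close> meaningful.\<close>

lemma vN_entropy_nonneg:
  assumes A: "psd n A" and tr: "(\<Sum>l<n. Re (A $$ (l, l))) = 1"
  shows "0 \<le> vN_entropy A"
proof -
  obtain U d where sp: "spectral n A U d" and d: "\<And>i. i < n \<Longrightarrow> 0 \<le> d i"
    using psd_spectral[OF A] by blast
  have unit: "(\<Sum>l<n. (cmod (U l r))\<^sup>2) = 1" if "r < n" for r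
  proof -
    have "complex_of_real (\<Sum>l<n. (cmod (U l r))\<^sup>2) = 1"
      using orthonormal_rowsD[of n "\<lambda>i l. U l i" r r] sp that
      unfolding of_real_sum complex_norm_square by (simp add: spectral_def)
    thus ?thesis by (simp only: of_real_eq_1_iff)
  qed
  have "1 = (\<Sum>l<n. \<Sum>r<n. d r * (cmod (U l r))\<^sup>2)" using tr spectral_diag[OF sp] by simp
  also have "\<dots> = (\<Sum>r<n. d r * (\<Sum>l<n. (cmod (U l r))\<^sup>2))"
    unfolding sum_distrib_left by (rule sum.swap)
  also have "\<dots> = (\<Sum>r<n. d r)" by (intro sum.cong refl) (simp add: unit)
  finally have sum1: "(\<Sum>r<n. d r) = 1" by simp
  have "d i \<le> 1" if "i < n" for i
    using member_le_sum[of i "{..<n}" d] d that sum1 by simp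
  hence "0 \<le> (\<Sum>i<n. eta (d i))" using d by (intro sum_nonneg eta_nonneg) auto
  thus ?thesis using sp by (simp add: spectral_def)
qed

section \<open>Bipartite states\<close>

text \<open>The reduced state of the first factor for the bipartite amplitude \<open>M\<close>.\<close>

definition gram :: "nat \<Rightarrow> nat \<Rightarrow> (nat \<Rightarrow> nat \<Rightarrow> complex) \<Rightarrow> complex mat" where
  "gram a b M = mat a a (\<lambda>(i, i'). \<Sum>j<b. M i j * cnj (M i' j))"

lemma gram_psd: "psd a (gram a b M)"
  by (rule psd_gram[where I = "{..<b}" and c = "\<lambda>_. 1" and f = "\<lambda>j i. M i j"]) (auto simp: gram_def)

lemma gram_diag: "i < a \<Longrightarrow> Re (gram a b M $$ (i, i)) = (\<Sum>j<b. (cmod (M i j))\<^sup>2)"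
  by (simp add: gram_def cmod_power2 flip: power2_eq_square)

text \<open>For the coefficient matrix \<open>N\<close> of a bipartite vector, the two reduced
  states are \<open>N * dagger N\<close> and the transpose of \<open>dagger N * N\<close>, so they
  have equal entropy. Thus one entanglement term serves both orientations of the bound.\<close>

lemma vN_entropy_gram_swap: "vN_entropy (gram a b M) = vN_entropy (gram b a (\<lambda>j i. M i j))"
proof -
  define N where "N = mat a b (\<lambda>(i, j). M i j)"
  have N: "N \<in> carrier_mat a b" by (simp add: N_def)
  have "gram a b M = N * dagger N"
    by (intro eq_matI) (auto simp: gram_def N_def scalar_prod_def lessThan_atLeast0)
  moreover have "gram b a (\<lambda>j i. M i j) = transpose_mat (dagger N * N)"
    by (intro eq_matI) (auto simp: gram_def N_def scalar_prod_def lessThan_atLeast0 mult.commute)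
  moreover have "dagger N * N \<in> carrier_mat b b" using N by auto
  ultimately show ?thesis
    using vN_entropy_mult_commute[OF N dagger_carrier[OF N]]
    by (simp add: vN_entropy_def char_poly_transpose_mat)
qed

section \<open>Product indices and bounds from single decompositions\<close>

lemma prod_index_less: "k < m \<Longrightarrow> i < d \<Longrightarrow> k * d + i < m * d" for k m i d :: nat
proof -
  assume "k < m" "i < d"
  hence "k * d + i < Suc k * d" "Suc k * d \<le> m * d" by (simp_all del: mult_Suc) simp
  thus ?thesis by simp
qed

lemma sum_prod_index: "(\<Sum>r<m * d. g r) = (\<Sum>k<m. \<Sum>i<d. g (k * d + i))" for m d :: nat
proof -
  have "(\<Sum>k<m. \<Sum>i<d. g (k * d + i)) = (\<Sum>(k, i)\<in>{..<m} \<times> {..<d}. g (k * d + i))"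
    by (rule sum.cartesian_product)
  also have "\<dots> = (\<Sum>r<m * d. g r)"
    by (rule sum.reindex_bij_witness[where i = "\<lambda>r. (r div d, r mod d)" and j = "\<lambda>(k, i). k * d + i"])
      (auto simp: prod_index_less less_mult_imp_div_less intro!: mod_less_divisor gr0I)
  finally show ?thesis by simp
qed

lemma vN_entropy_dephase_proj:
  "vN_entropy (dephase n (proj n \<psi>)) = (\<Sum>i<n. eta ((cmod (\<psi> $ i))\<^sup>2))"
  unfolding vN_entropy_dephase
  by (intro sum.cong refl) (simp add: proj_def cmod_power2 flip: power2_eq_square)

text \<open>The work lies in boundedness from below, without which a real infimum need not lie below
  the members of its set.\<close>

lemma coh_form_le:
  assumes "(m, p, \<psi>) \<in> pure_decomps n \<rho>"
  shows "coh_form n \<rho> \<le> (\<Sum>k<m. p k * vN_entropy (dephase n (proj n (\<psi> k))))"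
  unfolding coh_form_def
proof (rule cInf_lower)
  have "0 \<le> (\<Sum>k<m. p k * vN_entropy (dephase n (proj n (\<psi> k))))"
    if "(m, p, \<psi>) \<in> pure_decomps n \<rho>" for m p \<psi>
  proof (intro sum_nonneg mult_nonneg_nonneg)
    fix k assume "k \<in> {..<m}"
    with that have pk: "0 \<le> p k" and u: "(\<Sum>i<n. (cmod (\<psi> k $ i))\<^sup>2) = 1"
      by (auto simp: pure_decomps_def Defs.unit_vec_def)
    show "0 \<le> p k" by fact
    have "(cmod (\<psi> k $ i))\<^sup>2 \<le> 1" if "i < n" for i
      using member_le_sum[of i "{..<n}" "\<lambda>i. (cmod (\<psi> k $ i))\<^sup>2"] that u by simp
    thus "0 \<le> vN_entropy (dephase n (proj n (\<psi> k)))"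
      unfolding vN_entropy_dephase_proj by (intro sum_nonneg eta_nonneg) auto
  qed
  thus "bdd_below {\<Sum>k<m. p k * vN_entropy (dephase n (proj n (\<psi> k))) | m p \<psi>. (m, p, \<psi>) \<in> pure_decomps n \<rho>}"
    by (intro bdd_belowI[of _ 0]) auto
qed (use assms in blast)

lemma ptrace_A_proj:
  "ptrace_A a b (proj (a * b) \<psi>) = gram b a (\<lambda>j i. \<psi> $ (i * b + j))"
  by (intro eq_matI) (auto simp: ptrace_A_def gram_def proj_def prod_index_less)

lemma ent_form_le:
  assumes "(m, p, \<psi>) \<in> pure_decomps (a * b) \<rho>"
  shows "ent_form a b \<rho> \<le> (\<Sum>k<m. p k * vN_entropy (gram b a (\<lambda>j i. \<psi> k $ (i * b + j))))"
  unfolding ent_form_def ptrace_A_proj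
proof (rule cInf_lower)
  have "0 \<le> (\<Sum>k<m. p k * vN_entropy (gram b a (\<lambda>j i. \<psi> k $ (i * b + j))))"
    if "(m, p, \<psi>) \<in> pure_decomps (a * b) \<rho>" for m p \<psi>
  proof (intro sum_nonneg mult_nonneg_nonneg)
    fix k assume "k \<in> {..<m}"
    with that have pk: "0 \<le> p k" and u: "(\<Sum>i<a * b. (cmod (\<psi> k $ i))\<^sup>2) = 1"
      by (auto simp: pure_decomps_def Defs.unit_vec_def)
    show "0 \<le> p k" by fact
    have "(\<Sum>j<b. Re (gram b a (\<lambda>j i. \<psi> k $ (i * b + j)) $$ (j, j))) = (\<Sum>i<a * b. (cmod (\<psi> k $ i))\<^sup>2)"
      unfolding sum_prod_index by (subst sum.swap) (simp add: gram_diag)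
    thus "0 \<le> vN_entropy (gram b a (\<lambda>j i. \<psi> k $ (i * b + j)))"
      using u by (intro vN_entropy_nonneg[OF gram_psd]) simp
  qed
  thus "bdd_below {\<Sum>k<m. p k * vN_entropy (gram b a (\<lambda>j i. \<psi> k $ (i * b + j))) | m p \<psi>.
      (m, p, \<psi>) \<in> pure_decomps (a * b) \<rho>}"
    by (intro bdd_belowI[of _ 0]) auto
qed (use assms in blast)

text \<open>For positive weights, log (x / q) splits and the terms in \<open>log 2 q\<close> sum to
  \<open>- eta q\<close>. Zero weights are treated apart, because the logarithm does not split
  there.\<close>

lemma entropy_chain_rule:
  fixes n :: nat
  assumes x: "\<And>j. j < n \<Longrightarrow> 0 \<le> x j"
  defines "q \<equiv> (\<Sum>j<n. x j)"
  shows "eta q + q * (\<Sum>j<n. eta (x j / q)) = (\<Sum>j<n. eta (x j))"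
proof (cases "q = 0")
  case True
  hence "x j = 0" if "j < n" for j
    using x that unfolding q_def by (intro sum_nonneg_0[of "{..<n}" x]) auto
  thus ?thesis using True by simp
next
  case False
  have "0 \<le> q" using x by (auto simp: q_def intro!: sum_nonneg)
  with False have q: "0 < q" by simp
  have "q * eta (x j / q) = eta (x j) + x j * log 2 q" if "j < n" for j
  proof (cases "x j = 0")
    case False
    with x[OF that] have "0 < x j" by simp
    thus ?thesis using q by (simp add: eta_def log_divide algebra_simps)
  qed simp
  hence "q * (\<Sum>j<n. eta (x j / q)) = (\<Sum>j<n. eta (x j) + x j * log 2 q)"
    unfolding sum_distrib_left by (intro sum.cong refl) simp
  hence "q * (\<Sum>j<n. eta (x j / q)) = (\<Sum>j<n. eta (x j)) + q * log 2 q"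
    by (simp only: sum.distrib q_def sum_distrib_right)
  thus ?thesis by (simp add: eta_def[of q])
qed

text \<open>Measuring the first factor of each pure state in the reference basis leaves the second factor in the
  pure states proportional to \<open>M k i\<close>, which decompose the second reduced state; the chain rule splits the
  entropy of the joint outcome accordingly.\<close>

lemma coherence_tradeoff:
  fixes m :: nat
  assumes p: "\<And>k. k < m \<Longrightarrow> 0 \<le> p k"
    and unit: "\<And>k. k < m \<Longrightarrow> (\<Sum>i<a. \<Sum>j<b. (cmod (M k i j))\<^sup>2) = 1"
    and RA: "RA = mat a a (\<lambda>(i, i'). \<Sum>k<m. complex_of_real (p k) * (\<Sum>j<b. M k i j * cnj (M k i' j)))"
    and RB: "RB = mat b b (\<lambda>(j, j'). \<Sum>k<m. complex_of_real (p k) * (\<Sum>i<a. M k i j * cnj (M k i j')))"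
  shows "rel_coh a RA + coh_form b RB + (\<Sum>k<m. p k * vN_entropy (gram a b (M k)))
    \<le> (\<Sum>k<m. p k * (\<Sum>i<a. \<Sum>j<b. eta ((cmod (M k i j))\<^sup>2)))"
proof -
  define q where "q k i = (\<Sum>j<b. (cmod (M k i j))\<^sup>2)" for k i
  have q: "0 \<le> q k i" for k i by (simp add: q_def sum_nonneg)
  \<comment> \<open>The normalized state of the second factor after outcome \<open>i\<close>. For an
    outcome of probability 0 the first basis vector is a placeholder, because decompositions require
    unit vectors even at weight 0.\<close>
  define \<phi> where "\<phi> k i = vec b (\<lambda>j. if q k i = 0 then of_bool (j = 0) else M k i j / complex_of_real (sqrt (q k i)))" for k i
  have \<phi>_norm: "q k i * (cmod (\<phi> k i $ j))\<^sup>2 = (cmod (M k i j))\<^sup>2 \<and> (q k i \<noteq> 0 \<longrightarrow> (cmod (\<phi> k i $ j))\<^sup>2 = (cmod (M k i j))\<^sup>2 / q k i)"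
    if j: "j < b" for k i j
  proof (cases "q k i = 0")
    case True
    hence "(cmod (M k i j))\<^sup>2 = 0" using j unfolding q_def
      by (intro sum_nonneg_0[of "{..<b}" "\<lambda>j. (cmod (M k i j))\<^sup>2"]) auto
    thus ?thesis using True by simp
  next
    case False
    thus ?thesis using j q[of k i] by (simp add: \<phi>_def norm_divide power_divide)
  qed
  have \<phi>_outer: "complex_of_real (q k i) * (\<phi> k i $ j * cnj (\<phi> k i $ j')) = M k i j * cnj (M k i j')"
    if j: "j < b" "j' < b" for k i j j'
  proof (cases "q k i = 0")
    case True
    hence "M k i j = 0" using \<phi>_norm[OF j(1), of k i] by simp
    thus ?thesis using True by simp
  next
    case False
    have "complex_of_real (sqrt (q k i)) * complex_of_real (sqrt (q k i)) = complex_of_real (q k i)"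
      using q[of k i] by (simp flip: of_real_mult)
    thus ?thesis using j False by (simp add: \<phi>_def)
  qed
  \<comment> \<open>Pairs of a member \<open>k\<close> and an outcome \<open>i\<close> are flattened
    to \<open>r = k * a + i\<close>, since decompositions are indexed by an initial segment of the
    naturals.\<close>
  let ?P = "\<lambda>r. p (r div a) * q (r div a) (r mod a)"
  let ?\<phi> = "\<lambda>r. \<phi> (r div a) (r mod a)"
  have decomp: "(m * a, ?P, ?\<phi>) \<in> pure_decomps b RB"
  proof -
    have "0 \<le> ?P r \<and> Defs.unit_vec b (?\<phi> r)" if r: "r < m * a" for r
    proof -
      let ?k = "r div a" and ?i = "r mod a"
      have k: "?k < m" using r by (simp add: less_mult_imp_div_less)
      have "b \<noteq> 0" using unit[OF k] by (intro notI) simp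
      hence "(\<Sum>j<b. (cmod (\<phi> ?k ?i $ j))\<^sup>2) = 1"
      proof (cases "q ?k ?i = 0")
        case True
        hence "(\<Sum>j<b. (cmod (\<phi> ?k ?i $ j))\<^sup>2) = (\<Sum>j<b. if j = 0 then 1 else 0)"
          by (intro sum.cong refl) (simp add: \<phi>_def)
        thus ?thesis using \<open>b \<noteq> 0\<close> by simp
      next
        case False
        hence "(\<Sum>j<b. (cmod (\<phi> ?k ?i $ j))\<^sup>2) = (\<Sum>j<b. (cmod (M ?k ?i j))\<^sup>2 / q ?k ?i)"
          using \<phi>_norm by (intro sum.cong refl) auto
        also have "\<dots> = 1" using False by (simp add: q_def flip: sum_divide_distrib)
        finally show ?thesis .
      qed
      moreover have "\<phi> ?k ?i \<in> carrier_vec b" by (simp add: \<phi>_def)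
      ultimately show ?thesis using p[OF k] q by (simp add: Defs.unit_vec_def)
    qed
    moreover have "RB = mat b b (\<lambda>(j, j'). \<Sum>r<m * a. complex_of_real (?P r) * (proj b (?\<phi> r) $$ (j, j')))"
      unfolding RB sum_prod_index
      by (intro eq_matI) (auto simp: proj_def sum_distrib_left mult.assoc \<phi>_outer intro!: sum.cong)
    ultimately show ?thesis by (simp add: pure_decomps_def)
  qed
  have "coh_form b RB \<le> (\<Sum>r<m * a. ?P r * vN_entropy (dephase b (proj b (?\<phi> r))))"
    by (rule coh_form_le[OF decomp])
  also have "\<dots> = (\<Sum>k<m. \<Sum>i<a. p k * (q k i * (\<Sum>j<b. eta ((cmod (M k i j))\<^sup>2 / q k i))))"
    unfolding sum_prod_index
  proof (intro sum.cong refl)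
    fix k i assume "i \<in> {..<a}"
    hence i: "i < a" by simp
    show "?P (k * a + i) * vN_entropy (dephase b (proj b (?\<phi> (k * a + i))))
      = p k * (q k i * (\<Sum>j<b. eta ((cmod (M k i j))\<^sup>2 / q k i)))"
      using i \<phi>_norm by (cases "q k i = 0") (auto simp: vN_entropy_dephase_proj)
  qed
  finally have coh: "coh_form b RB \<le> (\<Sum>k<m. p k * (\<Sum>i<a. q k i * (\<Sum>j<b. eta ((cmod (M k i j))\<^sup>2 / q k i))))"
    by (simp add: sum_distrib_left)
  have RA_eq: "RA $$ (i, i') = (\<Sum>k<m. complex_of_real (p k) * gram a b (M k) $$ (i, i'))" if "i < a" "i' < a" for i i'
    using that by (simp add: RA gram_def)
  have "psd a RA"
  proof (rule psd_gram[where I = "{..<m} \<times> {..<b}" and c = "\<lambda>(k, j). p k" and f = "\<lambda>(k, j) i. M k i j"])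
    show "RA \<in> carrier_mat a a" by (simp add: RA)
    show "RA $$ (i, i') = (\<Sum>r\<in>{..<m} \<times> {..<b}. complex_of_real ((\<lambda>(k, j). p k) r)
        * ((\<lambda>(k, j) i. M k i j) r i * cnj ((\<lambda>(k, j) i. M k i j) r i')))" if "i < a" "i' < a" for i i'
      using that by (simp add: RA sum_distrib_left sum.cartesian_product case_prod_unfold)
  qed (use p in auto)
  hence "rel_coh a RA \<le> (\<Sum>k<m. p k * rel_coh a (gram a b (M k)))"
    using p RA_eq by (intro rel_coh_convex gram_psd) auto
  \<comment> \<open>The diagonal of each Gram matrix is the outcome distribution \<open>q k\<close>.
    The entropy subtracted here is the entanglement term, which moves to the left side of the
    goal.\<close>
  also have "\<dots> = (\<Sum>k<m. p k * (\<Sum>i<a. eta (q k i))) - (\<Sum>k<m. p k * vN_entropy (gram a b (M k)))"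
    by (simp add: rel_coh_def vN_entropy_dephase gram_diag q_def right_diff_distrib sum_subtractf)
  finally have "rel_coh a RA + coh_form b RB + (\<Sum>k<m. p k * vN_entropy (gram a b (M k)))
    \<le> (\<Sum>k<m. p k * (\<Sum>i<a. eta (q k i) + q k i * (\<Sum>j<b. eta ((cmod (M k i j))\<^sup>2 / q k i))))"
    using coh by (simp add: sum.distrib distrib_left)
  also have "\<dots> = (\<Sum>k<m. p k * (\<Sum>i<a. \<Sum>j<b. eta ((cmod (M k i j))\<^sup>2)))"
    unfolding q_def by (subst entropy_chain_rule) auto
  finally show ?thesis .
qed

section \<open>Decompositions of density matrices and the final bound\<close>

lemma density_psd:
  assumes "density n \<rho>"
  shows "psd n \<rho>"
proof -
  have \<rho>: "\<rho> \<in> carrier_mat n n" using assms by (simp add: density_def)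
  have "dagger \<rho> = \<rho>"
  proof (intro eq_matI)
    fix i j assume ij: "i < dim_row \<rho>" "j < dim_col \<rho>"
    hence "j < n" "i < n" using \<rho> by auto
    hence "\<rho> $$ (i, j) = cnj (\<rho> $$ (j, i))" using assms unfolding density_def by blast
    thus "dagger \<rho> $$ (i, j) = \<rho> $$ (i, j)" using ij \<rho> by (simp only: dagger_index carrier_matD)
  qed (use \<rho> in auto)
  moreover have "0 \<le> Re (qform n \<rho> v)" for v
  proof -
    have "\<forall>u\<in>carrier_vec n. 0 \<le> Re (\<Sum>i<n. \<Sum>j<n. cnj (u $ i) * \<rho> $$ (i, j) * u $ j)"
      using assms unfolding density_def by blast
    from bspec[OF this vec_carrier[of n v]] show ?thesis
      by (simp add: qform_def del: Re_sum)
  qed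
  ultimately show ?thesis using \<rho> by (simp add: psd_def)
qed

text \<open>The eigendecomposition is one. Existence matters because a lower bound passes to a real
  infimum only when the set is nonempty.\<close>

lemma pure_decomps_nonempty:
  assumes "psd n \<rho>"
  shows "\<exists>m p \<psi>. (m, p, \<psi>) \<in> pure_decomps n \<rho>"
proof -
  obtain U d where sp: "spectral n \<rho> U d" and d: "\<And>i. i < n \<Longrightarrow> 0 \<le> d i"
    using psd_spectral[OF assms] by blast
  have "Defs.unit_vec n (vec n (\<lambda>i. U i r))" if "r < n" for r
  proof -
    have "complex_of_real (\<Sum>l<n. (cmod (U l r))\<^sup>2) = 1"
      using orthonormal_rowsD[of n "\<lambda>i l. U l i" r r] sp that
      unfolding of_real_sum complex_norm_square by (simp add: spectral_def)
    hence "(\<Sum>l<n. (cmod (U l r))\<^sup>2) = 1" by (simp only: of_real_eq_1_iff)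
    thus ?thesis by (simp add: Defs.unit_vec_def)
  qed
  moreover have "\<rho> = mat n n (\<lambda>(i, j). \<Sum>r<n. complex_of_real (d r) * (proj n (vec n (\<lambda>i. U i r)) $$ (i, j)))"
    using assms sp by (intro eq_matI) (auto simp: psd_def proj_def spectral_def)
  ultimately have "(n, d, \<lambda>r. vec n (\<lambda>i. U i r)) \<in> pure_decomps n \<rho>"
    using d by (simp add: pure_decomps_def)
  thus ?thesis by blast
qed

theorem theorem1:
  fixes dA dB :: nat and \<rho> :: "complex mat"
  assumes "density (dA * dB) \<rho>"
  shows "coh_form (dA * dB) \<rho> \<ge>
           max (rel_coh dA (ptrace_B dA dB \<rho>) + coh_form dB (ptrace_A dA dB \<rho>))
               (rel_coh dB (ptrace_A dA dB \<rho>) + coh_form dA (ptrace_B dA dB \<rho>))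
         + ent_form dA dB \<rho>"
  unfolding coh_form_def[of "dA * dB" \<rho>]
\<comment> \<open>It suffices to bound the value of each decomposition. The same decomposition
  bounds \<open>ent_form\<close> from above, so no infimum has to be attained.\<close>
proof (rule cInf_greatest)
  show "{\<Sum>k<m. p k * vN_entropy (dephase (dA * dB) (proj (dA * dB) (\<psi> k))) | m p \<psi>.
      (m, p, \<psi>) \<in> pure_decomps (dA * dB) \<rho>} \<noteq> {}"
    using pure_decomps_nonempty[OF density_psd[OF assms]] by blast
next
  fix x assume "x \<in> {\<Sum>k<m. p k * vN_entropy (dephase (dA * dB) (proj (dA * dB) (\<psi> k))) | m p \<psi>.
      (m, p, \<psi>) \<in> pure_decomps (dA * dB) \<rho>}"
  then obtain m p \<psi> where x: "x = (\<Sum>k<m. p k * vN_entropy (dephase (dA * dB) (proj (dA * dB) (\<psi> k))))"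
    and dec: "(m, p, \<psi>) \<in> pure_decomps (dA * dB) \<rho>" by blast
  define M where "M k i j = \<psi> k $ (i * dB + j)" for k i j
  have p: "0 \<le> p k" and unit: "(\<Sum>i<dA. \<Sum>j<dB. (cmod (M k i j))\<^sup>2) = 1" if "k < m" for k
    using dec that by (auto simp: pure_decomps_def Defs.unit_vec_def sum_prod_index M_def)
  have unit': "(\<Sum>j<dB. \<Sum>i<dA. (cmod (M k i j))\<^sup>2) = 1" if "k < m" for k
    using unit[OF that] by (subst sum.swap)
  have \<rho>: "\<rho> $$ (i * dB + j, i' * dB + j') = (\<Sum>k<m. complex_of_real (p k) * (M k i j * cnj (M k i' j')))"
    if "i < dA" "i' < dA" "j < dB" "j' < dB" for i i' j j'
    using dec that by (simp add: pure_decomps_def proj_def M_def prod_index_less)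
  have B: "ptrace_B dA dB \<rho> = mat dA dA (\<lambda>(i, i'). \<Sum>k<m. complex_of_real (p k) * (\<Sum>j<dB. M k i j * cnj (M k i' j)))"
  proof (intro eq_matI)
    fix i i' assume "i < dim_row (mat dA dA (\<lambda>(i, i'). \<Sum>k<m. complex_of_real (p k) * (\<Sum>j<dB. M k i j * cnj (M k i' j))))"
      "i' < dim_col (mat dA dA (\<lambda>(i, i'). \<Sum>k<m. complex_of_real (p k) * (\<Sum>j<dB. M k i j * cnj (M k i' j))))"
    thus "ptrace_B dA dB \<rho> $$ (i, i') = mat dA dA (\<lambda>(i, i'). \<Sum>k<m. complex_of_real (p k) * (\<Sum>j<dB. M k i j * cnj (M k i' j))) $$ (i, i')"
      by (simp add: ptrace_B_def \<rho> sum_distrib_left) (rule sum.swap)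
  qed (auto simp: ptrace_B_def)
  have A: "ptrace_A dA dB \<rho> = mat dB dB (\<lambda>(j, j'). \<Sum>k<m. complex_of_real (p k) * (\<Sum>i<dA. M k i j * cnj (M k i j')))"
  proof (intro eq_matI)
    fix j j' assume "j < dim_row (mat dB dB (\<lambda>(j, j'). \<Sum>k<m. complex_of_real (p k) * (\<Sum>i<dA. M k i j * cnj (M k i j'))))"
      "j' < dim_col (mat dB dB (\<lambda>(j, j'). \<Sum>k<m. complex_of_real (p k) * (\<Sum>i<dA. M k i j * cnj (M k i j'))))"
    thus "ptrace_A dA dB \<rho> $$ (j, j') = mat dB dB (\<lambda>(j, j'). \<Sum>k<m. complex_of_real (p k) * (\<Sum>i<dA. M k i j * cnj (M k i j'))) $$ (j, j')"
      by (simp add: ptrace_A_def \<rho> sum_distrib_left) (rule sum.swap)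
  qed (auto simp: ptrace_A_def)
  have x_eq: "x = (\<Sum>k<m. p k * (\<Sum>i<dA. \<Sum>j<dB. eta ((cmod (M k i j))\<^sup>2)))"
    by (simp add: x vN_entropy_dephase_proj sum_prod_index M_def)
  have x_eq': "x = (\<Sum>k<m. p k * (\<Sum>j<dB. \<Sum>i<dA. eta ((cmod (M k i j))\<^sup>2)))"
    unfolding x_eq by (rule sum.cong[OF refl], subst sum.swap, rule refl)
  have E: "ent_form dA dB \<rho> \<le> (\<Sum>k<m. p k * vN_entropy (gram dB dA (\<lambda>j i. M k i j)))"
    using ent_form_le[OF dec] by (simp add: M_def)
  \<comment> \<open>The factors exchange roles by transposing the amplitudes; the Gram matrix is
    then the reduced state of the second factor, the one \<open>ent_form\<close> refers to.\<close>
  moreover have "rel_coh dB (ptrace_A dA dB \<rho>) + coh_form dA (ptrace_B dA dB \<rho>)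
      + (\<Sum>k<m. p k * vN_entropy (gram dB dA (\<lambda>j i. M k i j))) \<le> x"
    unfolding x_eq' by (rule coherence_tradeoff[where M = "\<lambda>k j i. M k i j"]) (use p unit' A B in auto)
  \<comment> \<open>In this orientation the tradeoff yields the entropy of the first reduced state,
    so the swap of Gram matrices is required.\<close>
  moreover have "rel_coh dA (ptrace_B dA dB \<rho>) + coh_form dB (ptrace_A dA dB \<rho>)
      + (\<Sum>k<m. p k * vN_entropy (gram dB dA (\<lambda>j i. M k i j))) \<le> x"
    unfolding x_eq vN_entropy_gram_swap[of dA dB, symmetric]
    by (rule coherence_tradeoff[where M = M]) (use p unit A B in auto)
  ultimately show "max (rel_coh dA (ptrace_B dA dB \<rho>) + coh_form dB (ptrace_A dA dB \<rho>))
      (rel_coh dB (ptrace_A dA dB \<rho>) + coh_form dA (ptrace_B dA dB \<rho>)) + ent_form dA dB \<rho> \<le> x"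
    by linarith
qed

end
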